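(* Let $T_1,T_2$ be geometric actions of a finitely generated group $G$ on $\mathbb{R}$-trees. Then there is a set $D\subset T_1\times T_2$, which is a finite union of compact rectangles, such that $\mathcal{C}(T_1\times T_2)\subset\overline{G.D}$.
   Context: An $\mathbb{R}$-tree is a geodesic metric space containing no embedded topological circle; actions are isometric; $G$ acts diagonally on $T_1\times T_2$. A compact rectangle is a product $I_1\times I_2$ of compact segments $I_i\subset T_i$. Core: a direction in $T$ based at $x$ is a connected component of $T\setminus\{x\}$. A quadrant is a product $\delta_1\times\delta_2\subset T_1\times T_2$ of directions. Fix a base point $*=( *_1,*_2)$ (the choice does not matter). A quadrant $Q$ is heavy if there is a sequence $\gamma_k\in G$ with $\gamma_k.*\in Q$ and $d(\gamma_k.*_i,*_i)\to\infty$ for both $i=1,2$; otherwise light. The core $\mathcal{C}(T_1\times T_2)$ is the complement in $T_1\times T_2$ of the union of all light quadrants. Geometric actions: a measured foliation $\mathcal{F}$ on a simplicial $2$-complex $X$ is a choice, for each closed simplex $\sigma$, of an affine (possibly constant) map $f_\sigma:\sigma\to\mathbb{R}$, defined up to post-composition by an isometry of $\mathbb{R}$, such that for each face $\tau$ of $\sigma$, $f_\tau=\varphi\circ(f_\sigma)_{|\tau}$ for some isometry $\varphi$ of $\mathbb{R}$. An edge is transverse if its map is non-constant; it then carries the metric given by the transverse measure. The transverse measure $\mu(c)$ of a path $c$ in a simplex $\sigma$ that is transverse or parallel to the level sets of $f_\sigma$ is the length of $f_\sigma(c([0,1]))$; for a path that is piecewise transverse or parallel, $\mu(c)$ is the sum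 over the pieces. Put $\delta(x,y)=\inf\{\mu(c)\mid c \text{ joining } x \text{ to } y\}$. The leaf space made Hausdorff $X/\mathcal{F}$ is the metric space obtained from $X$ by identifying points at pseudo-distance $\delta=0$. An action of $G$ on $T$ is dual to a foliated $2$-complex $(X,\mathcal{F})$ endowed with an action of $G$ preserving $\mathcal{F}$ if there is an equivariant isometry between $T$ and $X/\mathcal{F}$ and each transverse edge of $X$ isometrically embeds into $X/\mathcal{F}$. The action of a finitely generated group $G$ on $T$ is geometric if it is dual to a (connected) foliated $2$-complex on which $G$ acts freely, properly discontinuously and cocompactly. *)

theory Defs
  imports "HOL-Analysis.Analysis" "HOL-Algebra.Group_Action" "HOL-Algebra.Generated_Groups"
begin

section \<open>Real trees and isometric actions\<close>

definition geodesic_on :: "real \<Rightarrow> (real \<Rightarrow> 'a::metric_space) \<Rightarrow> bool" where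
  "geodesic_on l \<gamma> \<longleftrightarrow>
     0 \<le> l \<and> (\<forall>s\<in>{0..l}. \<forall>t\<in>{0..l}. dist (\<gamma> s) (\<gamma> t) = \<bar>s - t\<bar>)"

class real_tree = metric_space +
  assumes geodesic: "\<exists>\<gamma>. geodesic_on (dist x y) \<gamma> \<and> \<gamma> 0 = x \<and> \<gamma> (dist x y) = y"
    and no_circle: "\<not> S homeomorphic sphere (0::complex) 1"

text \<open>Degenerate segments (single points) are allowed: a real tree may be a point.\<close>

definition compact_segment :: "'a::metric_space set \<Rightarrow> bool" where
  "compact_segment I \<longleftrightarrow> (\<exists>l \<gamma>. geodesic_on l \<gamma> \<and> I = \<gamma> ` {0..l})"

definition compact_rectangle :: "('a::metric_space \<times> 'b::metric_space) set \<Rightarrow> bool" where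
  "compact_rectangle R \<longleftrightarrow>
     (\<exists>I\<^sub>1 I\<^sub>2. compact_segment I\<^sub>1 \<and> compact_segment I\<^sub>2 \<and> R = I\<^sub>1 \<times> I\<^sub>2)"

definition finitely_generated_group :: "('g, 'm) monoid_scheme \<Rightarrow> bool" where
  "finitely_generated_group G \<longleftrightarrow>
     group G \<and> (\<exists>S. finite S \<and> S \<subseteq> carrier G \<and> generate G S = carrier G)"

definition isometry :: "('a::metric_space \<Rightarrow> 'b::metric_space) \<Rightarrow> bool" where
  "isometry h \<longleftrightarrow> surj h \<and> (\<forall>x y. dist (h x) (h y) = dist x y)"

definition isometric_action ::
    "('g, 'm) monoid_scheme \<Rightarrow> ('g \<Rightarrow> 'a::metric_space \<Rightarrow> 'a) \<Rightarrow> bool" where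
  "isometric_action G \<alpha> \<longleftrightarrow> group_action G UNIV \<alpha> \<and> (\<forall>g\<in>carrier G. isometry (\<alpha> g))"

definition diagonal :: "('g \<Rightarrow> 'a \<Rightarrow> 'a) \<Rightarrow> ('g \<Rightarrow> 'b \<Rightarrow> 'b) \<Rightarrow> 'g \<Rightarrow> 'a \<times> 'b \<Rightarrow> 'a \<times> 'b" where
  "diagonal \<alpha>\<^sub>1 \<alpha>\<^sub>2 g = map_prod (\<alpha>\<^sub>1 g) (\<alpha>\<^sub>2 g)"


section \<open>The core\<close>

definition direction :: "'a::metric_space set \<Rightarrow> bool" where
  "direction \<delta> \<longleftrightarrow> (\<exists>x. \<delta> \<in> components (UNIV - {x}))"

definition quadrant :: "('a::metric_space \<times> 'b::metric_space) set \<Rightarrow> bool" where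
  "quadrant Q \<longleftrightarrow> (\<exists>\<delta>\<^sub>1 \<delta>\<^sub>2. direction \<delta>\<^sub>1 \<and> direction \<delta>\<^sub>2 \<and> Q = \<delta>\<^sub>1 \<times> \<delta>\<^sub>2)"

definition heavy ::
    "('g, 'm) monoid_scheme \<Rightarrow> ('g \<Rightarrow> 'a::metric_space \<Rightarrow> 'a) \<Rightarrow> ('g \<Rightarrow> 'b::metric_space \<Rightarrow> 'b)
      \<Rightarrow> 'a \<times> 'b \<Rightarrow> ('a \<times> 'b) set \<Rightarrow> bool" where
  "heavy G \<alpha>\<^sub>1 \<alpha>\<^sub>2 b Q \<longleftrightarrow>
     (\<exists>\<gamma>::nat \<Rightarrow> 'g.
        (\<forall>k. \<gamma> k \<in> carrier G \<and> diagonal \<alpha>\<^sub>1 \<alpha>\<^sub>2 (\<gamma> k) b \<in> Q) \<and>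
        filterlim (\<lambda>k. dist (\<alpha>\<^sub>1 (\<gamma> k) (fst b)) (fst b)) at_top sequentially \<and>
        filterlim (\<lambda>k. dist (\<alpha>\<^sub>2 (\<gamma> k) (snd b)) (snd b)) at_top sequentially)"

definition core ::
    "('g, 'm) monoid_scheme \<Rightarrow> ('g \<Rightarrow> 'a::metric_space \<Rightarrow> 'a) \<Rightarrow> ('g \<Rightarrow> 'b::metric_space \<Rightarrow> 'b)
      \<Rightarrow> 'a \<times> 'b \<Rightarrow> ('a \<times> 'b) set" where
  "core G \<alpha>\<^sub>1 \<alpha>\<^sub>2 b = UNIV - \<Union>{Q. quadrant Q \<and> \<not> heavy G \<alpha>\<^sub>1 \<alpha>\<^sub>2 b Q}"


section \<open>Simplicial 2-complexes\<close>

text \<open>An abstract simplicial complex of dimension at most two is given by its set of simplices,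
  identified with their vertex sets.\<close>

definition simplicial_2_complex :: "'v set set \<Rightarrow> bool" where
  "simplicial_2_complex K \<longleftrightarrow>
     (\<forall>\<sigma>\<in>K. finite \<sigma> \<and> \<sigma> \<noteq> {} \<and> card \<sigma> \<le> 3) \<and>
     (\<forall>\<sigma>\<in>K. \<forall>\<tau>. \<tau> \<subseteq> \<sigma> \<and> \<tau> \<noteq> {} \<longrightarrow> \<tau> \<in> K)"

text \<open>Points of the geometric realization are given by their barycentric coordinates.\<close>

definition closed_simplex :: "'v set \<Rightarrow> ('v \<Rightarrow> real) set" where
  "closed_simplex \<sigma> = {x. (\<forall>v. 0 \<le> x v) \<and> (\<forall>v. v \<notin> \<sigma> \<longrightarrow> x v = 0) \<and> sum x \<sigma> = 1}"

definition realization :: "'v set set \<Rightarrow> ('v \<Rightarrow> real) set" where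
  "realization K = (\<Union>\<sigma>\<in>K. closed_simplex \<sigma>)"

text \<open>The weak topology. On a single closed simplex, the topology of pointwise convergence
  (which the library puts on function types) is the Euclidean one.\<close>

definition weak_open :: "'v set set \<Rightarrow> ('v \<Rightarrow> real) set \<Rightarrow> bool" where
  "weak_open K U \<longleftrightarrow> U \<subseteq> realization K \<and>
     (\<forall>\<sigma>\<in>K. openin (top_of_set (closed_simplex \<sigma>)) (U \<inter> closed_simplex \<sigma>))"

definition weak_topology :: "'v set set \<Rightarrow> ('v \<Rightarrow> real) topology" where
  "weak_topology K = topology (weak_open K)"

lemma istopology_weak_open: "istopology (weak_open K)"
  unfolding istopology_def
proof (intro conjI allI impI)
  fix S T assume "weak_open K S" "weak_open K T"
  then show "weak_open K (S \<inter> T)"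
    unfolding weak_open_def
  proof (intro conjI ballI)
    assume *: "S \<subseteq> realization K \<and>
        (\<forall>\<sigma>\<in>K. openin (top_of_set (closed_simplex \<sigma>)) (S \<inter> closed_simplex \<sigma>))"
      and **: "T \<subseteq> realization K \<and>
        (\<forall>\<sigma>\<in>K. openin (top_of_set (closed_simplex \<sigma>)) (T \<inter> closed_simplex \<sigma>))"
    show "S \<inter> T \<subseteq> realization K" using * by blast
    fix \<sigma> assume "\<sigma> \<in> K"
    then have "openin (top_of_set (closed_simplex \<sigma>))
        ((S \<inter> closed_simplex \<sigma>) \<inter> (T \<inter> closed_simplex \<sigma>))"
      using * ** by - (rule openin_Int, blast+)
    moreover have "(S \<inter> closed_simplex \<sigma>) \<inter> (T \<inter> closed_simplex \<sigma>) = S \<inter> T \<inter> closed_simplex \<sigma>"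
      by blast
    ultimately show "openin (top_of_set (closed_simplex \<sigma>)) (S \<inter> T \<inter> closed_simplex \<sigma>)" by simp
  qed
next
  fix \<U> assume "\<forall>U\<in>\<U>. weak_open K U"
  then show "weak_open K (\<Union>\<U>)"
    unfolding weak_open_def
  proof (intro conjI ballI)
    assume *: "\<forall>U\<in>\<U>. U \<subseteq> realization K \<and>
        (\<forall>\<sigma>\<in>K. openin (top_of_set (closed_simplex \<sigma>)) (U \<inter> closed_simplex \<sigma>))"
    show "\<Union>\<U> \<subseteq> realization K" using * by blast
    fix \<sigma> assume "\<sigma> \<in> K"
    then have "openin (top_of_set (closed_simplex \<sigma>)) (\<Union>U\<in>\<U>. U \<inter> closed_simplex \<sigma>)"
      using * by (intro openin_Union) blast
    moreover have "(\<Union>U\<in>\<U>. U \<inter> closed_simplex \<sigma>) = \<Union>\<U> \<inter> closed_simplex \<sigma>" by blast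
    ultimately show "openin (top_of_set (closed_simplex \<sigma>)) (\<Union>\<U> \<inter> closed_simplex \<sigma>)" by simp
  qed
qed

lemma openin_weak_topology: "openin (weak_topology K) = weak_open K"
  by (simp add: weak_topology_def istopology_weak_open)

definition mix :: "real \<Rightarrow> ('v \<Rightarrow> real) \<Rightarrow> ('v \<Rightarrow> real) \<Rightarrow> 'v \<Rightarrow> real" where
  "mix t x y = (\<lambda>v. (1 - t) * x v + t * y v)"


section \<open>Measured foliations\<close>

text \<open>\<open>f \<sigma>\<close> is a representative of the map on \<open>\<sigma>\<close>, which matters only up to an isometry
  of the line; all notions below are invariant under changing the representatives.\<close>

definition measured_foliation :: "'v set set \<Rightarrow> ('v set \<Rightarrow> ('v \<Rightarrow> real) \<Rightarrow> real) \<Rightarrow> bool" where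
  "measured_foliation K f \<longleftrightarrow>
     (\<forall>\<sigma>\<in>K. \<forall>x\<in>closed_simplex \<sigma>. \<forall>y\<in>closed_simplex \<sigma>. \<forall>t\<in>{0..1}.
        f \<sigma> (mix t x y) = (1 - t) * f \<sigma> x + t * f \<sigma> y) \<and>
     (\<forall>\<sigma>\<in>K. \<forall>\<tau>\<in>K. \<tau> \<subseteq> \<sigma> \<longrightarrow>
        (\<exists>\<phi>::real \<Rightarrow> real. isometry \<phi> \<and> (\<forall>x\<in>closed_simplex \<tau>. f \<tau> x = \<phi> (f \<sigma> x))))"

definition transverse_edge :: "'v set set \<Rightarrow> ('v set \<Rightarrow> ('v \<Rightarrow> real) \<Rightarrow> real) \<Rightarrow> 'v set \<Rightarrow> bool" where
  "transverse_edge K f e \<longleftrightarrow> e \<in> K \<and> card e = 2 \<and> \<not> f e constant_on closed_simplex e"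

text \<open>A path \<open>c\<close> inside a simplex \<open>\<sigma>\<close> is parallel to the level sets if \<open>f \<sigma> \<circ> c\<close> is constant;
  it is transverse to them if \<open>f \<sigma> \<circ> c\<close> is injective (for a continuous real function on an interval
  this is the same as being locally injective, and as being strictly monotone).
  The relation says that \<open>c\<close> is piecewise transverse or parallel, of transverse measure \<open>m\<close>.\<close>

definition has_transverse_measure ::
    "'v set set \<Rightarrow> ('v set \<Rightarrow> ('v \<Rightarrow> real) \<Rightarrow> real) \<Rightarrow> (real \<Rightarrow> 'v \<Rightarrow> real) \<Rightarrow> real \<Rightarrow> bool" where
  "has_transverse_measure K f c m \<longleftrightarrow>
     path c \<and>
     (\<exists>(n::nat) (t::nat \<Rightarrow> real) (s::nat \<Rightarrow> 'v set).
        t 0 = 0 \<and> t n = 1 \<and>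
        (\<forall>i<n. t i < t (Suc i) \<and> s i \<in> K \<and>
               c ` {t i..t (Suc i)} \<subseteq> closed_simplex (s i) \<and>
               (inj_on (f (s i) \<circ> c) {t i..t (Suc i)} \<or>
                (f (s i) \<circ> c) constant_on {t i..t (Suc i)})) \<and>
        m = (\<Sum>i<n. measure lborel ((f (s i) \<circ> c) ` {t i..t (Suc i)})))"

definition leaf_pseudodist ::
    "'v set set \<Rightarrow> ('v set \<Rightarrow> ('v \<Rightarrow> real) \<Rightarrow> real) \<Rightarrow> ('v \<Rightarrow> real) \<Rightarrow> ('v \<Rightarrow> real) \<Rightarrow> real" where
  "leaf_pseudodist K f x y =
     Inf {m. \<exists>c. pathstart c = x \<and> pathfinish c = y \<and> has_transverse_measure K f c m}"

definition leaf_rel ::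
    "'v set set \<Rightarrow> ('v set \<Rightarrow> ('v \<Rightarrow> real) \<Rightarrow> real) \<Rightarrow> (('v \<Rightarrow> real) \<times> ('v \<Rightarrow> real)) set" where
  "leaf_rel K f =
     {(x, y). x \<in> realization K \<and> y \<in> realization K \<and> leaf_pseudodist K f x y = 0}"

text \<open>The leaf space made Hausdorff, with points the classes of \<open>leaf_rel\<close>. For a connected complex,
  \<open>leaf_pseudodist\<close> is a pseudo-distance, so \<open>leaf_dist\<close> does not depend on the
  representatives chosen.\<close>

definition leaf_space ::
    "'v set set \<Rightarrow> ('v set \<Rightarrow> ('v \<Rightarrow> real) \<Rightarrow> real) \<Rightarrow> ('v \<Rightarrow> real) set set" where
  "leaf_space K f = realization K // leaf_rel K f"

definition leaf_dist ::
    "'v set set \<Rightarrow> ('v set \<Rightarrow> ('v \<Rightarrow> real) \<Rightarrow> real) \<Rightarrow> ('v \<Rightarrow> real) set \<Rightarrow> ('v \<Rightarrow> real) set \<Rightarrow> real" where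
  "leaf_dist K f A B = leaf_pseudodist K f (SOME x. x \<in> A) (SOME y. y \<in> B)"


section \<open>Geometric actions\<close>

definition simplicial_action ::
    "('g, 'm) monoid_scheme \<Rightarrow> 'v set set \<Rightarrow> ('g \<Rightarrow> ('v \<Rightarrow> real) \<Rightarrow> ('v \<Rightarrow> real)) \<Rightarrow> bool" where
  "simplicial_action G K \<rho> \<longleftrightarrow>
     group_action G (realization K) \<rho> \<and>
     (\<forall>g\<in>carrier G. \<forall>\<sigma>\<in>K.
        (\<exists>\<sigma>'\<in>K. \<rho> g ` closed_simplex \<sigma> = closed_simplex \<sigma>') \<and>
        (\<forall>x\<in>closed_simplex \<sigma>. \<forall>y\<in>closed_simplex \<sigma>. \<forall>t\<in>{0..1}.
           \<rho> g (mix t x y) = mix t (\<rho> g x) (\<rho> g y)))"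

definition preserves_foliation ::
    "('g, 'm) monoid_scheme \<Rightarrow> 'v set set \<Rightarrow> ('v set \<Rightarrow> ('v \<Rightarrow> real) \<Rightarrow> real)
      \<Rightarrow> ('g \<Rightarrow> ('v \<Rightarrow> real) \<Rightarrow> ('v \<Rightarrow> real)) \<Rightarrow> bool" where
  "preserves_foliation G K f \<rho> \<longleftrightarrow>
     (\<forall>g\<in>carrier G. \<forall>\<sigma>\<in>K. \<forall>\<sigma>'\<in>K. \<rho> g ` closed_simplex \<sigma> = closed_simplex \<sigma>' \<longrightarrow>
        (\<exists>\<phi>::real \<Rightarrow> real. isometry \<phi> \<and> (\<forall>x\<in>closed_simplex \<sigma>. f \<sigma>' (\<rho> g x) = \<phi> (f \<sigma> x))))"

definition free_action ::
    "('g, 'm) monoid_scheme \<Rightarrow> 'x set \<Rightarrow> ('g \<Rightarrow> 'x \<Rightarrow> 'x) \<Rightarrow> bool" where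
  "free_action G E \<rho> \<longleftrightarrow> (\<forall>g\<in>carrier G. \<forall>x\<in>E. \<rho> g x = x \<longrightarrow> g = \<one>\<^bsub>G\<^esub>)"

definition properly_discontinuous_action ::
    "('g, 'm) monoid_scheme \<Rightarrow> 'x topology \<Rightarrow> ('g \<Rightarrow> 'x \<Rightarrow> 'x) \<Rightarrow> bool" where
  "properly_discontinuous_action G X \<rho> \<longleftrightarrow>
     (\<forall>C. compactin X C \<longrightarrow> finite {g \<in> carrier G. \<rho> g ` C \<inter> C \<noteq> {}})"

definition cocompact_action ::
    "('g, 'm) monoid_scheme \<Rightarrow> 'x topology \<Rightarrow> ('g \<Rightarrow> 'x \<Rightarrow> 'x) \<Rightarrow> bool" where
  "cocompact_action G X \<rho> \<longleftrightarrow>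
     (\<exists>C. compactin X C \<and> (\<Union>g\<in>carrier G. \<rho> g ` C) = topspace X)"

text \<open>The action induced on the leaf space takes a class to its image.\<close>

definition dual_to ::
    "('g, 'm) monoid_scheme \<Rightarrow> ('g \<Rightarrow> 'a::metric_space \<Rightarrow> 'a) \<Rightarrow> 'v set set
      \<Rightarrow> ('v set \<Rightarrow> ('v \<Rightarrow> real) \<Rightarrow> real) \<Rightarrow> ('g \<Rightarrow> ('v \<Rightarrow> real) \<Rightarrow> ('v \<Rightarrow> real)) \<Rightarrow> bool" where
  "dual_to G \<alpha> K f \<rho> \<longleftrightarrow>
     (\<exists>h. bij_betw h (UNIV::'a set) (leaf_space K f) \<and>
          (\<forall>x y. leaf_dist K f (h x) (h y) = dist x y) \<and>
          (\<forall>g\<in>carrier G. \<forall>x. h (\<alpha> g x) = \<rho> g ` h x)) \<and>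
     (\<forall>e. transverse_edge K f e \<longrightarrow>
          (\<forall>x\<in>closed_simplex e. \<forall>y\<in>closed_simplex e.
             leaf_dist K f (leaf_rel K f `` {x}) (leaf_rel K f `` {y}) = dist (f e x) (f e y)))"

text \<open>The type argument is the type from which the vertices of the complex are taken. HOL cannot
  quantify over types inside a formula; leaving this type variable free in a theorem that assumes
  geometricity makes the theorem apply to complexes with arbitrary vertex sets.\<close>

definition geometric_action ::
    "'v itself \<Rightarrow> ('g, 'm) monoid_scheme \<Rightarrow> ('g \<Rightarrow> 'a::metric_space \<Rightarrow> 'a) \<Rightarrow> bool" where
  "geometric_action _ G \<alpha> \<longleftrightarrow>
     isometric_action G \<alpha> \<and>
     (\<exists>(K::'v set set) f \<rho>.
        simplicial_2_complex K \<and> connected_space (weak_topology K) \<and>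
        measured_foliation K f \<and>
        simplicial_action G K \<rho> \<and> preserves_foliation G K f \<rho> \<and>
        free_action G (realization K) \<rho> \<and>
        properly_discontinuous_action G (weak_topology K) \<rho> \<and>
        cocompact_action G (weak_topology K) \<rho> \<and>
        dual_to G \<alpha> K f \<rho>)"

end

theory Submission
  imports Defs
begin

text \<open>
Write \<open>T\<^sub>1\<close>, \<open>T\<^sub>2\<close> for the trees and \<open>X\<^sub>1\<close>, \<open>X\<^sub>2\<close> for the foliated complexes. The map
\<open>X\<^sub>i \<rightarrow> T\<^sub>i\<close> pulls a connected open set back to a connected set, because the distance in the leaf
space is an infimum over paths: two points over a ball are joined by a path over a ball. Let \<open>D\<close>
be large enough that \<open>G.D\<close> contains the graphs of coarse equivariant maps \<open>X\<^sub>1 \<rightarrow> T\<^sub>2\<close> and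
\<open>X\<^sub>2 \<rightarrow> T\<^sub>1\<close>, together with, for every point \<open>w\<close> of \<open>X\<^sub>2\<close> and every point \<open>u\<close> of its coarse image
in \<open>T\<^sub>1\<close>, a set \<open>{u} \<times> Z\<close> with \<open>Z\<close> connected, that joins the image of \<open>w\<close> in \<open>T\<^sub>2\<close> to the image
of a point of \<open>X\<^sub>1\<close> over \<open>u\<close>.

Let \<open>x = (x\<^sub>1, x\<^sub>2)\<close> be outside the closure of \<open>G.D\<close>, so that a product \<open>B\<^sub>1 \<times> B\<^sub>2\<close> of
balls around \<open>x\<close> misses \<open>G.D\<close>. The image in \<open>T\<^sub>2\<close> of the part of \<open>X\<^sub>1\<close> over \<open>B\<^sub>1\<close> is a connected
set \<open>M\<^sub>2\<close> that misses \<open>B\<^sub>2\<close>; hence there is a direction \<open>\<eta>\<close> at a point \<open>y\<^sub>2\<close> of \<open>B\<^sub>2\<close> that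
contains \<open>x\<^sub>2\<close> and misses \<open>M\<^sub>2\<close>. Symmetrically there are \<open>M\<^sub>1\<close> and a direction \<open>\<delta>\<close> at a point
\<open>y\<^sub>1\<close> of \<open>B\<^sub>1\<close>. The quadrant \<open>\<delta> \<times> \<eta>\<close> contains \<open>x\<close>, and it contains no orbit point: from an orbit
point in it one could travel in \<open>X\<^sub>2\<close>, over \<open>\<eta>\<close>, to a point over \<open>x\<^sub>2\<close>. The image of this path
in \<open>T\<^sub>1\<close> goes from \<open>\<delta>\<close> to \<open>M\<^sub>1\<close>, so it crosses \<open>y\<^sub>1\<close>, over a point of \<open>\<eta>\<close>. Since \<open>y\<^sub>1\<close> is in
\<open>B\<^sub>1\<close>, the set \<open>{y\<^sub>1} \<times> Z\<close> attached to this point goes from \<open>\<eta>\<close> to \<open>M\<^sub>2\<close> and contains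
\<open>(y\<^sub>1, y\<^sub>2)\<close>, a point of \<open>B\<^sub>1 \<times> B\<^sub>2\<close> in \<open>G.D\<close>: a contradiction. So the quadrant is light and \<open>x\<close>
is not in the core.

The argument uses only the elements of \<open>G\<close> whose translates of a fundamental set lie
over a given part of a tree. The notion \<open>coarsely_connected_cover\<close> keeps this information and
forgets the complexes; \<open>exists_coarsely_connected_cover\<close> extracts it from a geometric action,
and \<open>connected_translates_over\<close> turns it into connected subsets of the other tree. On the side
of trees, the facts needed are that geodesics lie in every connected set containing their ends,
\<open>geodesic_subset_connected\<close>, and the resulting \<open>direction_separating_connected\<close>.
\<close>

section \<open>Geodesics in real trees\<close>

lemma arc_affine_reparametrization:
  fixes g :: "real \<Rightarrow> 'a::t2_space"
  assumes "continuous_on {p..q} g" "inj_on g {p..q}" "u \<in> {p..q}" "v \<in> {p..q}" "u \<noteq> v"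
  shows "arc (\<lambda>x. g ((v - u) * x + u))"
    and "path_image (\<lambda>x. g ((v - u) * x + u)) = g ` closed_segment u v"
proof -
  have img: "(\<lambda>x. (v - u) * x + u) ` {0..1} = closed_segment u v"
    by (auto simp: closed_segment_image_interval algebra_simps image_iff)
  have sub: "closed_segment u v \<subseteq> {p..q}"
    using assms(3,4) by (auto simp: closed_segment_eq_real_ivl split: if_splits)
  have "continuous_on {0..1} (g \<circ> (\<lambda>x. (v - u) * x + u))"
    by (intro continuous_on_compose continuous_intros)
       (use img sub assms(1) continuous_on_subset in \<open>metis\<close>)
  moreover have "inj_on (g \<circ> (\<lambda>x. (v - u) * x + u)) {0..1}"
    by (intro comp_inj_on)
       (use assms(5) img inj_on_subset[OF assms(2) sub] in \<open>auto simp: inj_on_def\<close>)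
  ultimately show "arc (\<lambda>x. g ((v - u) * x + u))"
    by (simp add: arc_def path_def comp_def)
  show "path_image (\<lambda>x. g ((v - u) * x + u)) = g ` closed_segment u v"
    unfolding path_image_def img[symmetric] by (simp add: image_image)
qed

text \<open>If a point of the first arc were off the second, the maximal open subarc around it that
  misses the second arc would have distinct ends on the second arc, and closing it up with the
  piece of the second arc between these ends would give an embedded circle.\<close>

lemma arc_images_subset:
  fixes g h :: "real \<Rightarrow> 'a::real_tree"
  assumes g: "continuous_on {p..q} g" "inj_on g {p..q}"
    and h: "continuous_on {p'..q'} h" "inj_on h {p'..q'}"
    and le: "p \<le> q" "p' \<le> q'" and ends: "g p = h p'" "g q = h q'"
  shows "g ` {p..q} \<subseteq> h ` {p'..q'}"
proof (rule ccontr)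
  define A where "A = h ` {p'..q'}"
  assume "\<not> ?thesis"
  then obtain t where t: "t \<in> {p..q}" "g t \<notin> A" unfolding A_def by blast
  have closedA: "closed A"
    unfolding A_def by (intro compact_imp_closed compact_continuous_image h compact_Icc)
  have endsA: "g p \<in> A" "g q \<in> A" using ends le by (auto simp: A_def)
  have comp: "compact {s \<in> {a..b}. g s \<in> A}" if "{a..b} \<subseteq> {p..q}" for a b
  proof -
    have "continuous_on {a..b} g" using g(1) that continuous_on_subset by blast
    then have "closed ({a..b} \<inter> g -` A)"
      using closedA by (intro continuous_closed_preimage) auto
    moreover have "{s \<in> {a..b}. g s \<in> A} = {a..b} \<inter> g -` A" by auto
    ultimately show ?thesis
      by (metis compact_Icc compact_Int_closed inf.left_idem)
  qed
  obtain s where s: "s \<in> {p..t}" "g s \<in> A" "\<And>s'. s' \<in> {p..t} \<Longrightarrow> g s' \<in> A \<Longrightarrow> s' \<le> s"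
    using compact_attains_sup[OF comp[of p t]] t endsA by fastforce
  obtain u where u: "u \<in> {t..q}" "g u \<in> A" "\<And>s'. s' \<in> {t..q} \<Longrightarrow> g s' \<in> A \<Longrightarrow> u \<le> s'"
    using compact_attains_inf[OF comp[of t q]] t endsA by fastforce
  have "s \<noteq> t" "u \<noteq> t" using s(2) u(2) t(2) by auto
  then have "s < u" using s(1) u(1) by auto
  have off: "g r \<notin> A" if "s < r" "r < u" for r
    using s(3)[of r] u(3)[of r] s(1) u(1) that by fastforce
  obtain a b where ab: "a \<in> {p'..q'}" "b \<in> {p'..q'}" "h a = g s" "h b = g u"
    using s(2) u(2) by (auto simp: A_def)
  have su: "s \<in> {p..q}" "u \<in> {p..q}" using s(1) u(1) t by auto
  have "g s \<noteq> g u" using \<open>s < u\<close> inj_onD[OF g(2) _ su] by auto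
  then have "b \<noteq> a" using ab by auto
  let ?g = "\<lambda>x. g ((u - s) * x + s)" and ?h = "\<lambda>x. h ((a - b) * x + b)"
  have arcs: "arc ?g" "arc ?h" "path_image ?g = g ` {s..u}"
    "path_image ?h = h ` closed_segment b a"
    using arc_affine_reparametrization[OF g su] \<open>s < u\<close>
      arc_affine_reparametrization[OF h ab(2,1) \<open>b \<noteq> a\<close>]
    by (auto simp: closed_segment_eq_real_ivl)
  have "h ` closed_segment b a \<subseteq> A"
    using ab by (auto simp: A_def closed_segment_eq_real_ivl split: if_splits)
  then have "path_image ?g \<inter> path_image ?h \<subseteq> {g s, g u}"
    using off unfolding arcs by (force simp: less_le)
  then have "simple_path (?g +++ ?h)"
    using arcs ab by (intro simple_path_join_loop) (auto simp: pathstart_def pathfinish_def)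
  then have "path_image (?g +++ ?h) homeomorphic sphere (0::complex) 1"
    by (rule homeomorphic_simple_path_image_circle)
      (simp only: pathstart_join pathfinish_join, simp_all add: pathstart_def pathfinish_def ab)
  with no_circle show False by blast
qed

lemma geodesic_onD:
  assumes "geodesic_on l \<gamma>"
  shows "continuous_on {0..l} \<gamma>" "inj_on \<gamma> {0..l}" "0 \<le> l"
proof -
  show "continuous_on {0..l} \<gamma>"
    using assms by (auto simp: continuous_on_iff geodesic_on_def dist_real_def)
  show "inj_on \<gamma> {0..l}" "0 \<le> l"
    using assms by (auto simp: inj_on_def geodesic_on_def) (metis abs_eq_0 atLeastAtMost_iff dist_self eq_iff_diff_eq_0)
qed

lemma geodesic_on_ends:
  assumes "geodesic_on l \<gamma>"
  shows "\<gamma> 0 \<in> \<gamma> ` {0..l}" "\<gamma> l \<in> \<gamma> ` {0..l}"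
  using geodesic_onD(3)[OF assms] by auto

text \<open>Two sides issued from a common vertex can only meet at equal parameters, so beyond their
  last common point they are disjoint and together form an arc joining the other two vertices; the
  third side is an arc with the same ends, hence has the same image.\<close>

lemma geodesic_triangle_thin:
  fixes \<gamma> \<alpha> \<beta> :: "real \<Rightarrow> 'a::real_tree"
  assumes \<gamma>: "geodesic_on l \<gamma>" and \<alpha>: "geodesic_on a \<alpha>" and \<beta>: "geodesic_on b \<beta>"
    and ends: "\<gamma> 0 = \<alpha> a" "\<gamma> l = \<beta> b" "\<alpha> 0 = \<beta> 0"
  shows "\<gamma> ` {0..l} \<subseteq> \<alpha> ` {0..a} \<union> \<beta> ` {0..b}"
proof -
  note \<gamma>' = geodesic_onD[OF \<gamma>] and \<alpha>' = geodesic_onD[OF \<alpha>] and \<beta>' = geodesic_onD[OF \<beta>]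
  have par: "s = t" if "\<alpha> s = \<beta> t" "s \<in> {0..a}" "t \<in> {0..b}" for s t
  proof -
    have "dist (\<alpha> 0) (\<alpha> s) = s" "dist (\<beta> 0) (\<beta> t) = t"
      using \<alpha> \<beta> that(2,3) by (simp_all add: geodesic_on_def)
    then show ?thesis using that ends by simp
  qed
  define S where "S = {t \<in> {0..min a b}. \<alpha> t = \<beta> t}"
  have "compact S"
  proof -
    have "continuous_on {0..min a b} (\<lambda>t. dist (\<alpha> t) (\<beta> t))"
      by (intro continuous_on_dist continuous_on_subset[OF \<alpha>'(1)] continuous_on_subset[OF \<beta>'(1)]) auto
    then have "closed ({0..min a b} \<inter> (\<lambda>t. dist (\<alpha> t) (\<beta> t)) -` {0})"
      by (intro continuous_closed_preimage) auto
    moreover have "S = {0..min a b} \<inter> (\<lambda>t. dist (\<alpha> t) (\<beta> t)) -` {0}" by (auto simp: S_def)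
    ultimately show ?thesis by (metis compact_Icc compact_Int_closed inf.left_idem)
  qed
  moreover have "0 \<in> S" using \<alpha>' \<beta>' ends by (auto simp: S_def)
  ultimately obtain m where m: "m \<in> S" and max: "\<And>t. t \<in> S \<Longrightarrow> t \<le> m"
    using compact_attains_sup[of S] by blast
  have mab: "0 \<le> m" "m \<le> a" "m \<le> b" "\<alpha> m = \<beta> m" using m by (auto simp: S_def)
  \<comment> \<open>The concatenation of the two sides beyond the point where they branch.\<close>
  define h where "h t = (if t \<le> 0 then \<alpha> (m - t) else \<beta> (m + t))" for t
  have conth: "continuous_on ({m - a..0} \<union> {0..b - m}) h"
    unfolding h_def
    by (intro continuous_on_cases continuous_on_compose2[OF \<alpha>'(1)] continuous_on_compose2[OF \<beta>'(1)]
        continuous_intros) (use mab in auto)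
  have "{m - a..0} \<union> {0..b - m} = {m - a..b - m}" using mab by auto
  with conth have conth: "continuous_on {m - a..b - m} h" by simp
  have cross: False if "s \<le> 0" "0 < t" "s \<ge> m - a" "t \<le> b - m" "\<alpha> (m - s) = \<beta> (m + t)" for s t
  proof -
    have "m - s = m + t" using that mab by (intro par) auto
    then have "m + t \<in> S" using that mab by (auto simp: S_def)
    with max that show False by fastforce
  qed
  have injh: "inj_on h {m - a..b - m}"
  proof (rule inj_onI)
    fix s t assume st: "s \<in> {m - a..b - m}" "t \<in> {m - a..b - m}" "h s = h t"
    consider "s \<le> 0" "t \<le> 0" | "0 < s" "0 < t" | "s \<le> 0" "0 < t" | "0 < s" "t \<le> 0" by linarith
    then show "s = t"
    proof cases
      case 1 then show ?thesis using st mab inj_onD[OF \<alpha>'(2), of "m - s" "m - t"] by (auto simp: h_def)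
    next
      case 2 then show ?thesis using st mab inj_onD[OF \<beta>'(2), of "m + s" "m + t"] by (auto simp: h_def)
    next
      case 3 then show ?thesis using st cross[of s t] by (auto simp: h_def)
    next
      case 4 then show ?thesis using st cross[of t s] by (auto simp: h_def)
    qed
  qed
  have "\<gamma> ` {0..l} \<subseteq> h ` {m - a..b - m}"
    by (rule arc_images_subset[OF \<gamma>'(1,2) conth injh])
       (use mab \<gamma>'(3) ends in \<open>simp_all add: h_def\<close>)
  also have "\<dots> \<subseteq> \<alpha> ` {0..a} \<union> \<beta> ` {0..b}"
  proof (intro image_subsetI)
    fix r assume "r \<in> {m - a..b - m}"
    then show "h r \<in> \<alpha> ` {0..a} \<union> \<beta> ` {0..b}"
      using mab by (cases "r \<le> 0") (auto simp: h_def)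
  qed
  finally show ?thesis .
qed

lemma geodesic_on_reverse: "geodesic_on l \<gamma> \<Longrightarrow> geodesic_on l (\<lambda>t. \<gamma> (l - t))"
  by (auto simp: geodesic_on_def)

lemma image_reverse: "(\<lambda>t. \<gamma> (l - t)) ` {0..l} = \<gamma> ` {0..l}" for l :: real
  using image_image[of \<gamma> "\<lambda>t. l - t" "{0..l}"] by simp

text \<open>Every interior point of a geodesic separates its ends. Being joined by a geodesic that
  avoids \<open>c\<close> is an equivalence relation on the complement of \<open>c\<close>, by thinness of triangles, and
  its classes are open; a connected set that misses \<open>c\<close> therefore lies in one class, whereas the
  ends of a geodesic through \<open>c\<close> do not.\<close>

lemma geodesic_subset_connected:
  fixes \<gamma> :: "real \<Rightarrow> 'a::real_tree"
  assumes \<gamma>: "geodesic_on l \<gamma>" and C: "connected C" "\<gamma> 0 \<in> C" "\<gamma> l \<in> C"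
  shows "\<gamma> ` {0..l} \<subseteq> C"
proof
  fix c assume c: "c \<in> \<gamma> ` {0..l}"
  show "c \<in> C"
  proof (rule ccontr)
    assume "c \<notin> C"
    define R where "R x y \<longleftrightarrow> (\<exists>m \<alpha>. geodesic_on m \<alpha> \<and> \<alpha> 0 = x \<and> \<alpha> m = y \<and> c \<notin> \<alpha> ` {0..m})"
      for x y
    have sym: "R y x" if "R x y" for x y
    proof -
      obtain m \<alpha> where "geodesic_on m \<alpha>" "\<alpha> 0 = x" "\<alpha> m = y" "c \<notin> \<alpha> ` {0..m}"
        using \<open>R x y\<close> unfolding R_def by blast
      then show ?thesis
        unfolding R_def by (intro exI[of _ m] exI[of _ "\<lambda>t. \<alpha> (m - t)"])
          (simp add: geodesic_on_reverse image_reverse)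
    qed
    have avoid: "c \<notin> \<beta> ` {0..m}"
      if R1: "R x z" and R2: "R z y" and \<beta>: "geodesic_on m \<beta>" "\<beta> 0 = x" "\<beta> m = y" for x y z m \<beta>
    proof -
      obtain m1 \<alpha>1 m2 \<alpha>2 where "geodesic_on m1 \<alpha>1" "\<alpha>1 0 = z" "\<alpha>1 m1 = x" "c \<notin> \<alpha>1 ` {0..m1}"
        "geodesic_on m2 \<alpha>2" "\<alpha>2 0 = z" "\<alpha>2 m2 = y" "c \<notin> \<alpha>2 ` {0..m2}"
        using sym[OF R1] R2 unfolding R_def by blast
      moreover from this have "\<beta> ` {0..m} \<subseteq> \<alpha>1 ` {0..m1} \<union> \<alpha>2 ` {0..m2}"
        using \<beta>(2,3) by (intro geodesic_triangle_thin[OF \<beta>(1)]) simp_all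
      ultimately show ?thesis by blast
    qed
    have trans: "R x y" if "R x z" "R z y" for x y z
    proof -
      obtain \<beta> where "geodesic_on (dist x y) \<beta>" "\<beta> 0 = x" "\<beta> (dist x y) = y"
        using geodesic by blast
      with avoid[OF that this] show ?thesis unfolding R_def by blast
    qed
    have near: "R x y" if "dist x y < dist x c" for x y
    proof -
      obtain \<beta> where \<beta>: "geodesic_on (dist x y) \<beta>" "\<beta> 0 = x" "\<beta> (dist x y) = y"
        using geodesic by blast
      have "dist x (\<beta> t) = t" if "t \<in> {0..dist x y}" for t
        using \<beta>(1,2) that by (auto simp: geodesic_on_def)
      then have "c \<notin> \<beta> ` {0..dist x y}" using that by auto
      then show ?thesis using \<beta> unfolding R_def by blast
    qed
    define a where "a = \<gamma> 0"
    have "R a a" using near[of a a] C \<open>c \<notin> C\<close> by (auto simp: a_def)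
    have "\<not> R a (\<gamma> l)"
    proof
      assume "R a (\<gamma> l)"
      then have "c \<notin> \<gamma> ` {0..l}"
        by (rule avoid[OF \<open>R a a\<close> _ \<gamma>]) (simp_all add: a_def)
      with c show False by simp
    qed
    have "open {z. z \<noteq> c \<and> R a z}" "open {z. z \<noteq> c \<and> \<not> R a z}"
    proof -
      have dst: "y \<noteq> c \<and> R x y \<and> R y x" if "dist y x < dist x c" for x y
        using near[of x y] sym[of x y] that by (auto simp: dist_commute)
      show "open {z. z \<noteq> c \<and> R a z}"
        unfolding open_dist
      proof (intro ballI exI conjI allI impI)
        fix x y assume "x \<in> {z. z \<noteq> c \<and> R a z}" "dist y x < dist x c"
        with dst[of y x] trans[of a x y] show "y \<in> {z. z \<noteq> c \<and> R a z}" by simp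
      qed simp
      show "open {z. z \<noteq> c \<and> \<not> R a z}"
        unfolding open_dist
      proof (intro ballI exI conjI allI impI)
        fix x y assume "x \<in> {z. z \<noteq> c \<and> \<not> R a z}" "dist y x < dist x c"
        with dst[of y x] trans[of a y x] show "y \<in> {z. z \<noteq> c \<and> \<not> R a z}" by auto
      qed simp
    qed
    then have "{z. z \<noteq> c \<and> R a z} \<inter> C = {} \<or> {z. z \<noteq> c \<and> \<not> R a z} \<inter> C = {}"
      using \<open>c \<notin> C\<close> by (intro connectedD[OF C(1)]) auto
    moreover have "a \<in> {z. z \<noteq> c \<and> R a z} \<inter> C" "\<gamma> l \<in> {z. z \<noteq> c \<and> \<not> R a z} \<inter> C"
      using \<open>R a a\<close> \<open>\<not> R a (\<gamma> l)\<close> C(2,3) \<open>c \<notin> C\<close> by (auto simp: a_def)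
    ultimately show False by blast
  qed
qed

lemma connected_compact_segment: "compact_segment I \<Longrightarrow> connected I"
  unfolding compact_segment_def
  by (auto intro!: connected_continuous_image geodesic_onD)

lemma compact_segment_singleton: "compact_segment {a}"
  unfolding compact_segment_def geodesic_on_def by (intro exI[of _ 0] exI[of _ "\<lambda>_. a"]) auto

lemma compact_segment_joining:
  fixes x y :: "'a::real_tree"
  obtains I where "compact_segment I" "x \<in> I" "y \<in> I"
    "\<And>C. connected C \<Longrightarrow> x \<in> C \<Longrightarrow> y \<in> C \<Longrightarrow> I \<subseteq> C"
proof -
  obtain \<gamma> where \<gamma>: "geodesic_on (dist x y) \<gamma>" "\<gamma> 0 = x" "\<gamma> (dist x y) = y"
    using geodesic by blast
  show ?thesis
  proof (rule that)
    show "compact_segment (\<gamma> ` {0..dist x y})"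
      using \<gamma>(1) unfolding compact_segment_def by blast
  qed (use geodesic_on_ends[OF \<gamma>(1)] geodesic_subset_connected[OF \<gamma>(1)] \<gamma>(2,3) in simp_all)
qed

lemma connected_ball_real_tree: "connected (ball x r)" for x :: "'a::real_tree"
proof (cases "r > 0")
  case True
  have "\<exists>I. connected I \<and> I \<subseteq> ball x r \<and> x \<in> I \<and> y \<in> I" if "y \<in> ball x r" for y
  proof -
    obtain \<gamma> where \<gamma>: "geodesic_on (dist x y) \<gamma>" "\<gamma> 0 = x" "\<gamma> (dist x y) = y"
      using geodesic by blast
    have "dist x (\<gamma> t) = t" if "t \<in> {0..dist x y}" for t
      using \<gamma> that by (auto simp: geodesic_on_def)
    then have "\<gamma> ` {0..dist x y} \<subseteq> ball x r" using that by auto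
    moreover have "connected (\<gamma> ` {0..dist x y})"
      using geodesic_onD[OF \<gamma>(1)] by (intro connected_continuous_image) auto
    ultimately show ?thesis
      using geodesic_on_ends[OF \<gamma>(1)] \<gamma>(2,3) by auto
  qed
  then obtain I where I: "\<And>y. y \<in> ball x r \<Longrightarrow> connected (I y) \<and> I y \<subseteq> ball x r \<and> x \<in> I y \<and> y \<in> I y"
    by metis
  then have "ball x r = (\<Union>y\<in>ball x r. I y)" by blast
  moreover have "connected (\<Union>y\<in>ball x r. I y)"
  proof (rule connected_Union)
    have "x \<in> \<Inter> (I ` ball x r)" using I by blast
    then show "\<Inter> (I ` ball x r) \<noteq> {}" by blast
  qed (use I in blast)
  ultimately show ?thesis by simp
next
  case False
  then show ?thesis by (simp add: ball_empty)
qed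

lemma open_component_real_tree:
  fixes U :: "'a::real_tree set"
  assumes "open U" "C \<in> components U"
  shows "open C"
  unfolding open_contains_ball
proof
  fix x assume "x \<in> C"
  then obtain e where e: "e > 0" "ball x e \<subseteq> U"
    using assms in_components_subset open_contains_ball by blast
  then have "ball x e \<subseteq> C"
    using components_maximal[OF assms(2) connected_ball_real_tree e(2)] \<open>x \<in> C\<close> centre_in_ball by blast
  with e show "\<exists>e>0. ball x e \<subseteq> C" by blast
qed

text \<open>The tool that produces light quadrants: the direction is cut off at a point of the ball
  on the way from \<open>x\<close> to \<open>M\<close>.\<close>

lemma direction_separating_connected:
  fixes x :: "'a::real_tree"
  assumes r: "r > 0" and M: "connected M" "M \<noteq> {}" "M \<inter> ball x r = {}"
  obtains y \<delta> where "y \<in> ball x r" "\<delta> \<in> components (UNIV - {y})" "x \<in> \<delta>" "\<delta> \<inter> M = {}"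
    "open \<delta>" "connected \<delta>"
proof -
  obtain m where m: "m \<in> M" using M by blast
  obtain \<gamma> where \<gamma>: "geodesic_on (dist x m) \<gamma>" "\<gamma> 0 = x" "\<gamma> (dist x m) = m"
    using geodesic by blast
  have far: "dist x m \<ge> r" using m M(3) by (auto simp: not_less[symmetric])
  \<comment> \<open>Any cut point at positive distance from \<open>x\<close> less than \<open>r\<close> works.\<close>
  define y where "y = \<gamma> (r / 2)"
  have dxy: "dist x y = r / 2" using \<gamma> far r by (auto simp: geodesic_on_def y_def)
  have ym: "y \<notin> M" using dxy r M(3) by auto
  have xy: "x \<noteq> y" using dxy r by auto
  obtain \<delta> where \<delta>: "\<delta> \<in> components (UNIV - {y})" "x \<in> \<delta>"
    using xy by (metis DiffI UNIV_I Union_components Union_iff singletonD)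
  have disj: "\<delta> \<inter> M = {}"
  proof (rule ccontr)
    assume "\<delta> \<inter> M \<noteq> {}"
    then have "connected (\<delta> \<union> M)"
      using \<delta> M by (intro connected_Un) (auto dest: in_components_connected)
    then have "\<gamma> ` {0..dist x m} \<subseteq> \<delta> \<union> M"
      using geodesic_subset_connected[OF \<gamma>(1)] \<gamma> \<delta> m by auto
    moreover have "y \<in> \<gamma> ` {0..dist x m}" using far r by (auto simp: y_def)
    ultimately show False using ym in_components_subset[OF \<delta>(1)] by blast
  qed
  have "open \<delta>"
    by (rule open_component_real_tree[OF _ \<delta>(1)]) (simp add: open_Diff)
  show ?thesis
  proof (rule that[of y \<delta>])
    show "y \<in> ball x r" using dxy r by simp
  qed (fact \<delta> disj \<open>open \<delta>\<close> in_components_connected[OF \<delta>(1)])+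
qed

definition segment_union :: "'a::metric_space set \<Rightarrow> bool" where
  "segment_union P \<longleftrightarrow> (\<exists>\<I>. finite \<I> \<and> (\<forall>I\<in>\<I>. compact_segment I) \<and> P = \<Union>\<I>)"

lemma segment_union_Un: "segment_union P \<Longrightarrow> segment_union Q \<Longrightarrow> segment_union (P \<union> Q)"
  unfolding segment_union_def by (metis Un_iff Union_Un_distrib finite_UnI)

lemma segment_union_compact_segment: "compact_segment I \<Longrightarrow> segment_union I"
  unfolding segment_union_def by (intro exI[of _ "{I}"]) auto

lemma segment_union_empty: "segment_union {}"
  unfolding segment_union_def by (intro exI[of _ "{}"]) auto

lemma segment_union_UN:
  "finite A \<Longrightarrow> (\<And>x. x \<in> A \<Longrightarrow> segment_union (P x)) \<Longrightarrow> segment_union (\<Union>x\<in>A. P x)"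
  by (induction A rule: finite_induct) (auto intro: segment_union_Un segment_union_empty)

text \<open>Join every segment, and every point of \<open>A\<close>, to a fixed point of the tree. Connected sets
  are what the proof needs: a connected set that meets a direction without lying in it contains
  its base point.\<close>

lemma segment_union_connected_hull:
  fixes P :: "'a::real_tree set"
  assumes P: "segment_union P" and A: "finite A"
  obtains Z where "segment_union Z" "connected Z" "P \<subseteq> Z" "A \<subseteq> Z"
proof -
  obtain \<I> where \<I>: "finite \<I>" "\<And>I. I \<in> \<I> \<Longrightarrow> compact_segment I" "P = \<Union>\<I>"
    using P unfolding segment_union_def by auto
  fix b :: 'a
  define \<J> where "\<J> = \<I> \<union> (\<lambda>a. {a}) ` (insert b A)"
  have \<J>: "finite \<J>" "\<And>I. I \<in> \<J> \<Longrightarrow> compact_segment I"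
    using \<I> A compact_segment_singleton by (auto simp: \<J>_def)
  have "\<exists>S. segment_union S \<and> connected S \<and> b \<in> S \<and> I \<subseteq> S" if "I \<in> \<J>" for I
  proof -
    obtain a where a: "a \<in> I"
      using \<J>(2)[OF \<open>I \<in> \<J>\<close>] geodesic_on_ends unfolding compact_segment_def by blast
    obtain J where J: "compact_segment J" "b \<in> J" "a \<in> J" by (rule compact_segment_joining)
    have "segment_union (J \<union> I)"
      using J \<J>(2)[OF that] by (intro segment_union_Un segment_union_compact_segment)
    moreover have "connected (J \<union> I)"
      using J a \<J>(2)[OF that] by (intro connected_Un connected_compact_segment) auto
    ultimately show ?thesis using J by blast
  qed
  then obtain S where S: "\<forall>I\<in>\<J>. segment_union (S I) \<and> connected (S I) \<and> b \<in> S I \<and> I \<subseteq> S I"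
    by (metis bchoice)
  show ?thesis
  proof (rule that)
    show "segment_union (\<Union>I\<in>\<J>. S I)" using S \<J> by (auto intro: segment_union_UN)
    show "connected (\<Union>I\<in>\<J>. S I)"
    proof (rule connected_Union)
      have "b \<in> \<Inter> (S ` \<J>)" using S by blast
      then show "\<Inter> (S ` \<J>) \<noteq> {}" by blast
    qed (use S in blast)
    have "\<Union>\<J> \<subseteq> (\<Union>I\<in>\<J>. S I)" using S by blast
    then show "P \<subseteq> (\<Union>I\<in>\<J>. S I)" "A \<subseteq> (\<Union>I\<in>\<J>. S I)"
      using \<I>(3) by (simp_all add: \<J>_def)
  qed
qed

lemma segment_union_Times_rectangles:
  assumes "segment_union P" "segment_union Q"
  shows "\<exists>\<R>. finite \<R> \<and> (\<forall>R\<in>\<R>. compact_rectangle R) \<and> P \<times> Q = \<Union>\<R>"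
proof -
  obtain \<I> where \<I>: "finite \<I>" "\<forall>I\<in>\<I>. compact_segment I" "P = \<Union>\<I>"
    using assms(1) unfolding segment_union_def by auto
  obtain \<J> where \<J>: "finite \<J>" "\<forall>I\<in>\<J>. compact_segment I" "Q = \<Union>\<J>"
    using assms(2) unfolding segment_union_def by auto
  define \<R> where "\<R> = {I \<times> J |I J. I \<in> \<I> \<and> J \<in> \<J>}"
  have "finite \<R>"
    unfolding \<R>_def by (rule finite_image_set2) (use \<I> \<J> in auto)
  moreover have "compact_rectangle R" if R: "R \<in> \<R>" for R
  proof -
    obtain I J where "I \<in> \<I>" "J \<in> \<J>" "R = I \<times> J"
      using R unfolding \<R>_def by blast
    then show ?thesis
      using \<I>(2) \<J>(2) unfolding compact_rectangle_def by blast
  qed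
  moreover have "P \<times> Q = \<Union>\<R>"
    unfolding \<R>_def \<I>(3) \<J>(3) by auto
  ultimately show ?thesis by (intro exI[of _ \<R>]) simp
qed


section \<open>Simplices and affine maps\<close>

lemma mix_ends [simp]: "mix 0 x y = x" "mix 1 x y = y"
  by (auto simp: mix_def)

lemma closed_simplex_mono:
  assumes "\<tau> \<subseteq> \<sigma>" "finite \<sigma>"
  shows "closed_simplex \<tau> \<subseteq> closed_simplex \<sigma>"
proof
  fix x assume x: "x \<in> closed_simplex \<tau>"
  then have "sum x \<sigma> = sum x \<tau>"
    using assms by (intro sum.mono_neutral_right) (auto simp: closed_simplex_def)
  then show "x \<in> closed_simplex \<sigma>" using x assms(1) by (auto simp: closed_simplex_def)
qed

definition vertex :: "'v \<Rightarrow> 'v \<Rightarrow> real" where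
  "vertex v = (\<lambda>w. if w = v then 1 else 0)"

lemma vertex_in_closed_simplex: "finite \<sigma> \<Longrightarrow> v \<in> \<sigma> \<Longrightarrow> vertex v \<in> closed_simplex \<sigma>"
  by (auto simp: vertex_def closed_simplex_def)

lemma mix_in_closed_simplex:
  assumes "x \<in> closed_simplex \<sigma>" "y \<in> closed_simplex \<sigma>" "t \<in> {0..1}"
  shows "mix t x y \<in> closed_simplex \<sigma>"
  using assms
  by (auto simp: closed_simplex_def mix_def sum.distrib sum_distrib_left[symmetric])

text \<open>Induction over the vertices of a face: a point is a mixture of the vertex removed and of
  a point of the opposite face.\<close>

lemma affine_on_simplex_eq_sum:
  fixes g :: "('v \<Rightarrow> real) \<Rightarrow> real"
  assumes aff: "\<And>x y t. x \<in> closed_simplex \<sigma> \<Longrightarrow> y \<in> closed_simplex \<sigma> \<Longrightarrow> t \<in> {0..1} \<Longrightarrow>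
      g (mix t x y) = (1 - t) * g x + t * g y"
    and \<sigma>: "finite \<sigma>" and z: "z \<in> closed_simplex \<sigma>"
  shows "g z = (\<Sum>v\<in>\<sigma>. z v * g (vertex v))"
proof -
  have "g z = (\<Sum>v\<in>\<tau>. z v * g (vertex v))"
    if "finite \<tau>" "\<tau> \<subseteq> \<sigma>" "z \<in> closed_simplex \<tau>" for \<tau> z
    using that
  proof (induction \<tau> arbitrary: z rule: finite_induct)
    case empty then show ?case by (simp add: closed_simplex_def)
  next
    case (insert v \<tau>)
    have z: "\<And>w. 0 \<le> z w" "\<And>w. w \<notin> insert v \<tau> \<Longrightarrow> z w = 0" "z v + sum z \<tau> = 1"
      using insert.prems insert.hyps by (auto simp: closed_simplex_def)
    show ?case
    proof (cases "z v = 1")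
      case True
      then have "sum z \<tau> = 0" using z by simp
      then have 0: "\<forall>w\<in>\<tau>. z w = 0"
        using z(1) insert.hyps(1) by (simp add: sum_nonneg_eq_0_iff)
      then have "z = vertex v" using True z by (fastforce simp: vertex_def)
      moreover have "(\<Sum>w\<in>\<tau>. z w * g (vertex w)) = 0" using 0 by simp
      ultimately show ?thesis using True insert.hyps by simp
    next
      case False
      have "0 \<le> sum z \<tau>" using z(1) by (simp add: sum_nonneg)
      then have "z v \<le> 1" using z(3) by linarith
      then have lt: "z v < 1" using False by simp
      define y where "y w = (if w = v then 0 else z w / (1 - z v))" for w
      have sumy: "(\<Sum>w\<in>\<tau>. y w * a w) = (\<Sum>w\<in>\<tau>. z w * a w) / (1 - z v)" for a
        unfolding sum_divide_distrib using insert.hyps(2) by (intro sum.cong) (auto simp: y_def)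
      have y: "y \<in> closed_simplex \<tau>"
        using z lt sumy[of "\<lambda>_. 1"] insert.hyps(2) by (auto simp: closed_simplex_def y_def)
      have ysub: "y \<in> closed_simplex \<sigma>" "vertex v \<in> closed_simplex \<sigma>"
        using closed_simplex_mono[of \<tau> \<sigma>] y insert.prems \<sigma>
        by (auto intro: vertex_in_closed_simplex)
      have "z = mix (z v) y (vertex v)"
        using lt by (auto simp: mix_def y_def vertex_def)
      then have "g z = (1 - z v) * g y + z v * g (vertex v)"
        using aff[OF ysub, of "z v"] lt z(1)[of v] by simp
      also have "(1 - z v) * g y = (\<Sum>w\<in>\<tau>. z w * g (vertex w))"
        using insert.IH[OF _ y] insert.prems sumy lt by simp
      finally show ?thesis using insert.hyps by simp
    qed
  qed
  from this[OF \<sigma> order_refl z] show ?thesis .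
qed

lemma affine_on_simplex_bounds:
  fixes g :: "('v \<Rightarrow> real) \<Rightarrow> real"
  assumes sum: "g z = (\<Sum>v\<in>\<sigma>. z v * g (vertex v))" and z: "z \<in> closed_simplex \<sigma>"
  shows "(\<And>v. v \<in> \<sigma> \<Longrightarrow> g (vertex v) \<le> b) \<Longrightarrow> g z \<le> b"
    and "(\<And>v. v \<in> \<sigma> \<Longrightarrow> a \<le> g (vertex v)) \<Longrightarrow> a \<le> g z"
proof -
  have z': "\<And>v. 0 \<le> z v" "sum z \<sigma> = 1" using z by (auto simp: closed_simplex_def)
  show "g z \<le> b" if "\<And>v. v \<in> \<sigma> \<Longrightarrow> g (vertex v) \<le> b"
  proof -
    have "g z \<le> (\<Sum>v\<in>\<sigma>. z v * b)"
      unfolding sum using that z' by (intro sum_mono mult_left_mono) auto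
    then show ?thesis using z' by (simp add: sum_distrib_right[symmetric])
  qed
  show "a \<le> g z" if "\<And>v. v \<in> \<sigma> \<Longrightarrow> a \<le> g (vertex v)"
  proof -
    have "(\<Sum>v\<in>\<sigma>. z v * a) \<le> g z"
      unfolding sum using that z' by (intro sum_mono mult_left_mono) auto
    then show ?thesis using z' by (simp add: sum_distrib_right[symmetric])
  qed
qed


section \<open>The weak topology\<close>

lemma closed_coordinate_constraint: "closed {x :: 'v \<Rightarrow> real. x v \<in> S}" if "closed S"
proof -
  have "closed ((\<lambda>x :: 'v \<Rightarrow> real. x v) -` S)"
    by (intro closed_vimage that) (intro continuous_on_product_coordinates)
  then show ?thesis by (simp add: vimage_def)
qed

text \<open>A singleton is cut out by one closed condition on each coordinate.\<close>

lemma closed_finite_functions: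
  fixes S :: "('v \<Rightarrow> real) set"
  assumes "finite S"
  shows "closed S"
proof -
  have "closed {x}" for x :: "'v \<Rightarrow> real"
  proof -
    have eq: "{x} = (\<Inter>v. {y. y v \<in> {x v}})" by auto
    show ?thesis
      by (subst eq, intro closed_INT ballI closed_coordinate_constraint closed_singleton)
  qed
  then have "closed (\<Union>x\<in>S. {x})" using assms by (intro closed_UN) auto
  then show ?thesis by simp
qed

lemma compact_closed_simplex:
  assumes "finite \<sigma>"
  shows "compact (closed_simplex \<sigma>)"
proof -
  have "compactin (product_topology (\<lambda>_::'a. euclidean :: real topology) UNIV)
      (PiE UNIV (\<lambda>_. {0..1}))"
    by (subst compactin_PiE) auto
  then have box: "compact (PiE UNIV (\<lambda>_::'a. {0..1::real}))"
    by (simp add: euclidean_product_topology)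
  have "closed_simplex \<sigma> = (PiE UNIV (\<lambda>_. {0..1})) \<inter>
      ((\<Inter>v\<in>-\<sigma>. {x. x v \<in> {0}}) \<inter> (\<lambda>x. sum x \<sigma>) -` {1})"
  proof (intro equalityI subsetI)
    fix x assume x: "x \<in> closed_simplex \<sigma>"
    have "x v \<le> 1" for v
    proof (cases "v \<in> \<sigma>")
      case True
      then have "x v \<le> sum x \<sigma>"
        using x assms by (intro member_le_sum) (auto simp: closed_simplex_def)
      then show ?thesis using x by (simp add: closed_simplex_def)
    qed (use x in \<open>simp add: closed_simplex_def\<close>)
    then show "x \<in> (PiE UNIV (\<lambda>_. {0..1})) \<inter>
      ((\<Inter>v\<in>-\<sigma>. {x. x v \<in> {0}}) \<inter> (\<lambda>x. sum x \<sigma>) -` {1})"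
      using x by (auto simp: closed_simplex_def)
  qed (auto simp: closed_simplex_def PiE_iff)
  moreover have "closed ((\<Inter>v\<in>-\<sigma>. {x::'a \<Rightarrow> real. x v \<in> {0}}) \<inter> (\<lambda>x. sum x \<sigma>) -` {1})"
    by (intro closed_Int closed_INT ballI closed_coordinate_constraint closed_vimage continuous_on_sum
        continuous_on_product_coordinates) auto
  ultimately show ?thesis using compact_Int_closed[OF box] by simp
qed

lemma topspace_weak_topology: "topspace (weak_topology K) = realization K"
proof -
  have "closed_simplex \<sigma> \<subseteq> realization K" if "\<sigma> \<in> K" for \<sigma>
    using that by (auto simp: realization_def)
  then have "weak_open K (realization K)"
    by (auto simp: weak_open_def inf.absorb2)
  then show ?thesis
    unfolding topspace_def openin_weak_topology by (auto simp: weak_open_def)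
qed

lemma compactin_closed_simplex:
  assumes "finite \<sigma>" "\<sigma> \<in> K"
  shows "compactin (weak_topology K) (closed_simplex \<sigma>)"
proof -
  have sub: "closed_simplex \<sigma> \<subseteq> realization K" using assms by (auto simp: realization_def)
  have "compactin (top_of_set (closed_simplex \<sigma>)) (closed_simplex \<sigma>)"
    using compact_closed_simplex[OF assms(1)] by (simp add: compact_imp_compactin_subtopology)
  moreover have "continuous_map (top_of_set (closed_simplex \<sigma>)) (weak_topology K) (\<lambda>x. x)"
    unfolding continuous_map_def
  proof (intro conjI allI impI)
    fix U assume "openin (weak_topology K) U"
    then have "openin (top_of_set (closed_simplex \<sigma>)) (U \<inter> closed_simplex \<sigma>)"
      using assms by (simp add: openin_weak_topology weak_open_def)
    moreover have "{x \<in> topspace (top_of_set (closed_simplex \<sigma>)). x \<in> U} = U \<inter> closed_simplex \<sigma>"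
      by auto
    ultimately show "openin (top_of_set (closed_simplex \<sigma>))
        {x \<in> topspace (top_of_set (closed_simplex \<sigma>)). x \<in> U}" by simp
  qed (use sub in \<open>auto simp: topspace_weak_topology\<close>)
  ultimately show ?thesis using image_compactin by fastforce
qed

definition support :: "('v \<Rightarrow> real) \<Rightarrow> 'v set" where
  "support x = {v. x v \<noteq> 0}"

lemma support_in_complex:
  assumes K: "simplicial_2_complex K" and x: "x \<in> realization K"
  shows "support x \<in> K" "x \<in> closed_simplex (support x)"
proof -
  obtain \<sigma> where \<sigma>: "\<sigma> \<in> K" "x \<in> closed_simplex \<sigma>" using x by (auto simp: realization_def)
  then have sub: "support x \<subseteq> \<sigma>" by (auto simp: support_def closed_simplex_def)
  have fin: "finite \<sigma>" using K \<sigma>(1) by (auto simp: simplicial_2_complex_def)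
  have "sum x (support x) = sum x \<sigma>"
    using sub fin by (intro sum.mono_neutral_left) (auto simp: support_def)
  then have s: "sum x (support x) = 1" using \<sigma>(2) by (simp add: closed_simplex_def)
  then have "support x \<noteq> {}" by auto
  then show "support x \<in> K" using K \<sigma>(1) sub unfolding simplicial_2_complex_def by meson
  show "x \<in> closed_simplex (support x)"
    using s \<sigma>(2) by (auto simp: closed_simplex_def support_def)
qed

text \<open>Choose one point of \<open>C\<close> in each open simplex that meets \<open>C\<close>. A closed simplex contains
  only finitely many of the chosen points, so each subset of them is closed in the weak topology;
  a closed discrete subset of a compact set is finite.\<close>

lemma compactin_subset_finite_simplices:
  assumes K: "simplicial_2_complex K" and C: "compactin (weak_topology K) C"
  obtains \<Phi> where "finite \<Phi>" "\<Phi> \<subseteq> K" "C \<subseteq> (\<Union>\<sigma>\<in>\<Phi>. closed_simplex \<sigma>)"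
proof -
  have CK: "C \<subseteq> realization K"
    using compactin_subset_topspace[OF C] by (simp add: topspace_weak_topology)
  have "\<forall>s\<in>support ` C. \<exists>x. x \<in> C \<and> support x = s" by auto
  then obtain x where x: "\<And>s. s \<in> support ` C \<Longrightarrow> x s \<in> C \<and> support (x s) = s" by metis
  define S where "S = x ` support ` C"
  \<comment> \<open>Each set of the cover contains exactly one of the chosen points.\<close>
  define U where "U s = realization K - (S - {x s})" for s
  have openU: "weak_open K (U s)" for s
    unfolding weak_open_def
  proof (intro conjI ballI)
    show "U s \<subseteq> realization K" by (auto simp: U_def)
    fix \<tau> assume \<tau>: "\<tau> \<in> K"
    then have fin: "finite \<tau>" using K by (auto simp: simplicial_2_complex_def)
    have "S \<inter> closed_simplex \<tau> \<subseteq> x ` Pow \<tau>"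
    proof
      fix z assume z: "z \<in> S \<inter> closed_simplex \<tau>"
      then obtain t where t: "t \<in> support ` C" "z = x t" by (auto simp: S_def)
      then have "support z = t" using x by simp
      then have "t \<subseteq> \<tau>" using z by (auto simp: support_def closed_simplex_def)
      then show "z \<in> x ` Pow \<tau>" using t by blast
    qed
    then have "finite (S \<inter> closed_simplex \<tau>)" 
      by (rule finite_surj[OF finite_Pow_iff[THEN iffD2, OF fin]])
    then have "finite ((S - {x s}) \<inter> closed_simplex \<tau>)"
      by (rule rev_finite_subset) auto
    then have "closed ((S - {x s}) \<inter> closed_simplex \<tau>)"
      by (rule closed_finite_functions)
    moreover have "U s \<inter> closed_simplex \<tau> =
        closed_simplex \<tau> \<inter> - ((S - {x s}) \<inter> closed_simplex \<tau>)"
      using \<tau> by (auto simp: U_def realization_def)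
    ultimately show "openin (top_of_set (closed_simplex \<tau>)) (U s \<inter> closed_simplex \<tau>)"
      by (simp only: openin_open_Int open_Compl)
  qed
  have "C \<subseteq> \<Union>(U ` support ` C)"
  proof
    fix z assume z: "z \<in> C"
    show "z \<in> \<Union>(U ` support ` C)"
    proof (cases "z \<in> S")
      case True
      then obtain s where "s \<in> support ` C" "z = x s" by (auto simp: S_def)
      then show ?thesis using z CK by (auto simp: U_def)
    next
      case False
      then show ?thesis using z CK by (auto simp: U_def)
    qed
  qed
  moreover have "openin (weak_topology K) V" if "V \<in> U ` support ` C" for V
    using that openU by (auto simp: openin_weak_topology)
  ultimately obtain \<F> where \<F>: "finite \<F>" "\<F> \<subseteq> U ` support ` C" "C \<subseteq> \<Union>\<F>"
    using compactinD[OF C, of "U ` support ` C"] by blast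
  obtain \<Sigma> where \<Sigma>: "\<Sigma> \<subseteq> support ` C" "finite \<Sigma>" "\<F> = U ` \<Sigma>"
    using finite_subset_image[OF \<F>(1,2)] by blast
  then have cover: "C \<subseteq> (\<Union>s\<in>\<Sigma>. U s)" using \<F>(3) by simp
  have "support ` C \<subseteq> \<Sigma>"
  proof
    fix s assume s: "s \<in> support ` C"
    then have "x s \<in> C" using x[OF s] by (elim conjunct1)
    then obtain t where t: "t \<in> \<Sigma>" "x s \<in> U t" using cover by blast
    moreover have "x s \<in> S" using s by (auto simp: S_def)
    ultimately have eq: "x s = x t" by (auto simp: U_def)
    have supp: "support (x s) = s" "support (x t) = t"
      using x[OF s] x[OF subsetD[OF \<Sigma>(1) t(1)]] by (elim conjunct2)+
    have "s = t" using arg_cong[OF eq, of support] by (simp only: supp)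
    then show "s \<in> \<Sigma>" using t by simp
  qed
  then have "finite (support ` C)" using \<Sigma>(2) finite_subset by blast
  moreover have "support ` C \<subseteq> K" using support_in_complex(1)[OF K] CK by blast
  moreover have "C \<subseteq> (\<Union>\<sigma>\<in>support ` C. closed_simplex \<sigma>)"
    using support_in_complex(2)[OF K] CK by blast
  ultimately show ?thesis by (rule that)
qed


section \<open>The leaf pseudodistance through chains\<close>

locale foliated_complex =
  fixes K :: "'v set set" and f :: "'v set \<Rightarrow> ('v \<Rightarrow> real) \<Rightarrow> real"
  assumes complex: "simplicial_2_complex K"
    and connected_complex: "connected_space (weak_topology K)"
    and foliation: "measured_foliation K f"
begin

lemma finite_simplex: "\<sigma> \<in> K \<Longrightarrow> finite \<sigma>"
  using complex by (auto simp: simplicial_2_complex_def)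

lemma face_in_complex: "\<sigma> \<in> K \<Longrightarrow> \<tau> \<subseteq> \<sigma> \<Longrightarrow> \<tau> \<noteq> {} \<Longrightarrow> \<tau> \<in> K"
  using complex unfolding simplicial_2_complex_def by meson

lemma foliation_affine:
  assumes "\<sigma> \<in> K" "x \<in> closed_simplex \<sigma>" "y \<in> closed_simplex \<sigma>" "t \<in> {0..1}"
  shows "f \<sigma> (mix t x y) = (1 - t) * f \<sigma> x + t * f \<sigma> y"
  using foliation assms by (auto simp: measured_foliation_def)

lemma foliation_eq_sum:
  assumes "\<sigma> \<in> K" "z \<in> closed_simplex \<sigma>"
  shows "f \<sigma> z = (\<Sum>v\<in>\<sigma>. z v * f \<sigma> (vertex v))"
  using foliation_affine finite_simplex assms by (intro affine_on_simplex_eq_sum[of \<sigma> "f \<sigma>"]) auto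

lemma continuous_on_foliation:
  assumes "\<sigma> \<in> K"
  shows "continuous_on (closed_simplex \<sigma>) (f \<sigma>)"
proof -
  have "continuous_on (closed_simplex \<sigma>) (\<lambda>z. \<Sum>v\<in>\<sigma>. z v * f \<sigma> (vertex v))"
    by (intro continuous_on_sum continuous_on_mult continuous_on_const
        continuous_on_subset[OF continuous_on_product_coordinates]) auto
  then show ?thesis
    using foliation_eq_sum[OF assms] by (simp cong: continuous_on_cong)
qed

text \<open>A chain is a sequence of points in which neighbours share a simplex; its cost is the
  transverse measure of the broken line through these points. Replacing paths by chains removes
  all path topology from the study of the leaf space.\<close>

inductive chain :: "('v \<Rightarrow> real) \<Rightarrow> ('v \<Rightarrow> real) \<Rightarrow> real \<Rightarrow> bool" where
  refl: "x \<in> realization K \<Longrightarrow> chain x x 0"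
| step: "chain x y m \<Longrightarrow> \<sigma> \<in> K \<Longrightarrow> y \<in> closed_simplex \<sigma> \<Longrightarrow> z \<in> closed_simplex \<sigma> \<Longrightarrow>
    chain x z (m + \<bar>f \<sigma> y - f \<sigma> z\<bar>)"

lemma closed_simplex_subset_realization: "\<sigma> \<in> K \<Longrightarrow> closed_simplex \<sigma> \<subseteq> realization K"
  by (auto simp: realization_def)

lemma chain_nonneg: "chain x y m \<Longrightarrow> 0 \<le> m"
  by (induction rule: chain.induct) auto

lemma chain_realization: "chain x y m \<Longrightarrow> x \<in> realization K \<and> y \<in> realization K"
  by (induction rule: chain.induct) (auto simp: realization_def)

lemma chain_trans:
  assumes "chain y z m'" "chain x y m"
  shows "chain x z (m + m')"
  using assms
proof (induction rule: chain.induct)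
  case (step y w m' \<sigma> z)
  then show ?case
    using chain.step[OF step.IH[OF step.prems] step.hyps(2-4)] by (simp add: add.assoc)
qed simp

lemma chain_simplex:
  assumes "\<sigma> \<in> K" "y \<in> closed_simplex \<sigma>" "z \<in> closed_simplex \<sigma>"
  shows "chain y z \<bar>f \<sigma> y - f \<sigma> z\<bar>"
  using chain.step[OF chain.refl[of y] assms] closed_simplex_subset_realization assms by auto

lemma chain_sym: "chain x y m \<Longrightarrow> chain y x m"
proof (induction rule: chain.induct)
  case (step x y m \<sigma> z)
  show ?case
    using chain_trans[OF step.IH chain_simplex[OF step.hyps(2,4,3)]]
    by (simp add: abs_minus_commute add.commute)
qed (rule chain.refl)

text \<open>The points reachable from \<open>x\<close> form a union of closed simplices, as does the set of the
  others, and both are open in the weak topology.\<close>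

lemma chain_exists:
  assumes x: "x \<in> realization K" and y: "y \<in> realization K"
  shows "\<exists>m. chain x y m"
proof -
  define S where "S = {z. \<exists>m. chain x z m}"
  have move: "z \<in> S \<longleftrightarrow> w \<in> S" if "\<sigma> \<in> K" "z \<in> closed_simplex \<sigma>" "w \<in> closed_simplex \<sigma>"
    for z w \<sigma>
    using that chain.step unfolding S_def by blast
  have "openin (weak_topology K) (realization K \<inter> S)" "openin (weak_topology K) (realization K - S)"
  proof -
    have half: "weak_open K (realization K \<inter> A)"
      if A: "\<And>z w \<sigma>. \<sigma> \<in> K \<Longrightarrow> z \<in> closed_simplex \<sigma> \<Longrightarrow> w \<in> closed_simplex \<sigma> \<Longrightarrow> z \<in> A \<Longrightarrow> w \<in> A"
      for A
      unfolding weak_open_def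
    proof (intro conjI ballI)
      fix \<sigma> assume \<sigma>: "\<sigma> \<in> K"
      then have "realization K \<inter> A \<inter> closed_simplex \<sigma> = {} \<or>
          realization K \<inter> A \<inter> closed_simplex \<sigma> = closed_simplex \<sigma>"
        using A[OF \<sigma>] closed_simplex_subset_realization[OF \<sigma>] by blast
      then show "openin (top_of_set (closed_simplex \<sigma>)) (realization K \<inter> A \<inter> closed_simplex \<sigma>)"
        by (elim disjE) simp_all
    qed simp
    show "openin (weak_topology K) (realization K \<inter> S)"
      unfolding openin_weak_topology by (rule half) (use move in blast)
    have "weak_open K (realization K \<inter> - S)"
      by (rule half) (use move in blast)
    then show "openin (weak_topology K) (realization K - S)"
      unfolding openin_weak_topology by (simp add: Diff_eq)
  qed
  moreover have "x \<in> realization K \<inter> S" using x chain.refl by (auto simp: S_def)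
  ultimately have "realization K - S = {}"
    using connected_complex unfolding connected_space_def topspace_weak_topology by blast
  then show ?thesis using y by (auto simp: S_def)
qed

lemma measure_of_monotone_piece:
  fixes c :: "real \<Rightarrow> 'v \<Rightarrow> real"
  assumes \<sigma>: "\<sigma> \<in> K" and ab: "a \<le> b" and c: "continuous_on {a..b} c" "c ` {a..b} \<subseteq> closed_simplex \<sigma>"
    and mono: "inj_on (f \<sigma> \<circ> c) {a..b} \<or> (f \<sigma> \<circ> c) constant_on {a..b}"
  shows "measure lborel ((f \<sigma> \<circ> c) ` {a..b}) = \<bar>f \<sigma> (c a) - f \<sigma> (c b)\<bar>"
proof -
  have cont: "continuous_on {a..b} (f \<sigma> \<circ> c)"
    using c continuous_on_subset[OF continuous_on_foliation[OF \<sigma>]] by (intro continuous_on_compose) auto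
  have "(f \<sigma> \<circ> c) ` {a..b} = closed_segment (f \<sigma> (c a)) (f \<sigma> (c b))"
    using mono
  proof
    assume "inj_on (f \<sigma> \<circ> c) {a..b}"
    then show ?thesis
      using continuous_injective_image_segment_1[of a b "f \<sigma> \<circ> c"] cont ab
      by (simp add: closed_segment_eq_real_ivl)
  next
    assume "(f \<sigma> \<circ> c) constant_on {a..b}"
    then obtain q where q: "\<And>r. r \<in> {a..b} \<Longrightarrow> f \<sigma> (c r) = q" by (auto simp: constant_on_def)
    then have "(f \<sigma> \<circ> c) ` {a..b} = (\<lambda>_. q) ` {a..b}" by (intro image_cong) auto
    then show ?thesis using q[of a] q[of b] ab by (simp add: image_constant_conv)
  qed
  then show ?thesis by (simp add: closed_segment_eq_real_ivl)
qed

lemma chain_of_measured_path: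
  assumes "has_transverse_measure K f c m"
  shows "chain (pathstart c) (pathfinish c) m"
proof -
  obtain n t s where path: "path c" and t: "t 0 = (0::real)" "t (n::nat) = 1"
    and pieces: "\<And>i. i < n \<Longrightarrow> t i < t (Suc i) \<and> s i \<in> K \<and> c ` {t i..t (Suc i)} \<subseteq> closed_simplex (s i) \<and>
      (inj_on (f (s i) \<circ> c) {t i..t (Suc i)} \<or> (f (s i) \<circ> c) constant_on {t i..t (Suc i)})"
    and m: "m = (\<Sum>i<n. measure lborel ((f (s i) \<circ> c) ` {t i..t (Suc i)}))"
    using assms unfolding has_transverse_measure_def by blast
  have lower: "0 \<le> t k" if "k \<le> n" for k
    using that
  proof (induction k)
    case (Suc k) then show ?case using pieces[of k] by simp
  qed (simp add: t)
  have upper: "t k \<le> 1" if "k \<le> n" for k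
    using that
  proof (induction rule: inc_induct)
    case (step k) then show ?case using pieces[of k] by simp
  qed (simp add: t)
  have "n \<noteq> 0" using t by (metis zero_neq_one)
  have "chain (c (t 0)) (c (t k)) (\<Sum>i<k. measure lborel ((f (s i) \<circ> c) ` {t i..t (Suc i)}))"
    if "k \<le> n" for k
    using that
  proof (induction k)
    case 0
    have "c (t 0) \<in> closed_simplex (s 0)" "s 0 \<in> K" using pieces[of 0] \<open>n \<noteq> 0\<close> by auto
    then show ?case using chain.refl closed_simplex_subset_realization by auto
  next
    case (Suc k)
    then have k: "k < n" by simp
    note p = pieces[OF k]
    have sub: "{t k..t (Suc k)} \<subseteq> {0..1}" using lower[of k] upper[of "Suc k"] k by auto
    have "continuous_on {t k..t (Suc k)} c"
      using path continuous_on_subset[OF _ sub] by (simp add: path_def)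
    then have "measure lborel ((f (s k) \<circ> c) ` {t k..t (Suc k)}) = \<bar>f (s k) (c (t k)) - f (s k) (c (t (Suc k)))\<bar>"
      using p by (intro measure_of_monotone_piece) auto
    moreover have "c (t k) \<in> closed_simplex (s k)" "c (t (Suc k)) \<in> closed_simplex (s k)"
      using p by auto
    ultimately show ?case
      using chain.step[OF Suc.IH, of "s k" "c (t (Suc k))"] p k by simp
  qed
  from this[of n] show ?thesis using t m by (simp add: pathstart_def pathfinish_def)
qed

lemma path_mix: "path (\<lambda>u. mix u y z)"
  unfolding path_def mix_def
  by (intro continuous_on_coordinatewise_then_product continuous_intros)

lemma has_transverse_measure_const:
  assumes "x \<in> realization K"
  shows "has_transverse_measure K f (\<lambda>_. x) 0"
proof -
  obtain \<sigma> where \<sigma>: "\<sigma> \<in> K" "x \<in> closed_simplex \<sigma>" using assms by (auto simp: realization_def)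
  show ?thesis
    unfolding has_transverse_measure_def
  proof (intro conjI exI)
    show "path (\<lambda>_. x)" by (simp add: path_def)
    show "(\<lambda>i. real i) 0 = 0" "(\<lambda>i. real i) 1 = 1" by auto
    show "\<forall>i<1. real i < real (Suc i) \<and> (\<lambda>_. \<sigma>) i \<in> K \<and>
        (\<lambda>_. x) ` {real i..real (Suc i)} \<subseteq> closed_simplex ((\<lambda>_. \<sigma>) i) \<and>
        (inj_on (f ((\<lambda>_. \<sigma>) i) \<circ> (\<lambda>_. x)) {real i..real (Suc i)} \<or>
         (f ((\<lambda>_. \<sigma>) i) \<circ> (\<lambda>_. x)) constant_on {real i..real (Suc i)})"
      using \<sigma> by (auto simp: constant_on_def)
    have "(f \<sigma> \<circ> (\<lambda>_. x)) ` {0..1::real} = {f \<sigma> x}"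
      by (simp add: comp_def image_constant_conv)
    then show "0 = (\<Sum>i<1. measure lborel
        ((f ((\<lambda>_. \<sigma>) i) \<circ> (\<lambda>_. x)) ` {real i..real (Suc i)}))"
      by simp
  qed
qed

text \<open>The new path runs through the old one on the first half of the parameter interval, so
  the old subdivision is halved and one piece is added. On that piece the transverse coordinate is
  affine, hence injective or constant.\<close>

lemma has_transverse_measure_append:
  assumes c: "has_transverse_measure K f c m" "pathfinish c = y"
    and \<sigma>: "\<sigma> \<in> K" "y \<in> closed_simplex \<sigma>" "z \<in> closed_simplex \<sigma>"
  shows "has_transverse_measure K f (c +++ (\<lambda>u. mix u y z)) (m + \<bar>f \<sigma> y - f \<sigma> z\<bar>)"
proof -
  let ?e = "\<lambda>u. mix u y z" and ?c = "c +++ (\<lambda>u. mix u y z)"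
  obtain n t s where path: "path c" and t: "t 0 = (0::real)" "t (n::nat) = 1"
    and pieces: "\<And>i. i < n \<Longrightarrow> t i < t (Suc i) \<and> s i \<in> K \<and> c ` {t i..t (Suc i)} \<subseteq> closed_simplex (s i) \<and>
      (inj_on (f (s i) \<circ> c) {t i..t (Suc i)} \<or> (f (s i) \<circ> c) constant_on {t i..t (Suc i)})"
    and m: "m = (\<Sum>i<n. measure lborel ((f (s i) \<circ> c) ` {t i..t (Suc i)}))"
    using c(1) unfolding has_transverse_measure_def by blast
  have upper: "t k \<le> 1" if "k \<le> n" for k
    using that
  proof (induction rule: inc_induct)
    case (step k) then show ?case using pieces[of k] by simp
  qed (simp add: t)
  define t' where "t' i = (if i \<le> n then t i / 2 else 1)" for i
  define s' where "s' i = (if i < n then s i else \<sigma>)" for i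
  have c1: "c 1 = y" using c(2) by (simp add: pathfinish_def)
  have left: "?c r = c (2 * r)" if "r \<le> 1/2" for r using that by (simp add: joinpaths_def)
  have right: "?c r = ?e (2 * r - 1)" if "1/2 \<le> r" for r
  proof (cases "r = 1/2")
    case True
    show ?thesis unfolding True using c1 by (simp add: joinpaths_def)
  qed (use that in \<open>simp add: joinpaths_def\<close>)
  have fe: "f \<sigma> (?e u) = f \<sigma> y + u * (f \<sigma> z - f \<sigma> y)" if "u \<in> {0..1}" for u
    using foliation_affine[OF \<sigma> that] by (simp add: algebra_simps)
  have old: "t' i < t' (Suc i) \<and> s' i \<in> K \<and> ?c ` {t' i..t' (Suc i)} \<subseteq> closed_simplex (s' i) \<and>
      (inj_on (f (s' i) \<circ> ?c) {t' i..t' (Suc i)} \<or> (f (s' i) \<circ> ?c) constant_on {t' i..t' (Suc i)}) \<and>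
      (f (s' i) \<circ> ?c) ` {t' i..t' (Suc i)} = (f (s i) \<circ> c) ` {t i..t (Suc i)}"
    if i: "i < n" for i
  proof -
    have ti: "t' i = t i / 2" "t' (Suc i) = t (Suc i) / 2" "s' i = s i"
      using i by (auto simp: t'_def s'_def)
    have eq: "?c r = c (2 * r)" if "r \<in> {t' i..t' (Suc i)}" for r
      using that upper[of "Suc i"] i by (intro left) (auto simp: ti)
    have dbl: "(\<lambda>r. 2 * r) ` {t' i..t' (Suc i)} = {t i..t (Suc i)}"
    proof (intro equalityI subsetI)
      fix r assume "r \<in> {t i..t (Suc i)}"
      then have "r / 2 \<in> {t' i..t' (Suc i)}" by (auto simp: ti)
      then show "r \<in> (\<lambda>r. 2 * r) ` {t' i..t' (Suc i)}" by (rule rev_image_eqI) simp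
    qed (auto simp: ti)
    have img: "(f (s' i) \<circ> ?c) ` {t' i..t' (Suc i)} = (f (s i) \<circ> c) ` {t i..t (Suc i)}"
      unfolding dbl[symmetric] image_image by (intro image_cong) (auto simp: eq ti)
    have imgc: "?c ` {t' i..t' (Suc i)} = c ` {t i..t (Suc i)}"
      unfolding dbl[symmetric] image_image by (intro image_cong) (auto simp: eq)
    have injc: "inj_on (f (s' i) \<circ> ?c) {t' i..t' (Suc i)}"
      if inj: "inj_on (f (s i) \<circ> c) {t i..t (Suc i)}"
    proof -
      have "inj_on ((f (s i) \<circ> c) \<circ> (\<lambda>r. 2 * r)) {t' i..t' (Suc i)}"
        by (rule comp_inj_on) (simp add: inj_on_def, simp only: dbl inj)
      then show ?thesis by (rule inj_on_cong[THEN iffD1, rotated]) (simp add: eq ti)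
    qed
    have constc: "(f (s' i) \<circ> ?c) constant_on {t' i..t' (Suc i)}"
      if const: "(f (s i) \<circ> c) constant_on {t i..t (Suc i)}"
    proof -
      obtain q where q: "\<And>r. r \<in> {t i..t (Suc i)} \<Longrightarrow> (f (s i) \<circ> c) r = q"
        using const unfolding constant_on_def by blast
      have "(f (s' i) \<circ> ?c) r = q" if "r \<in> {t' i..t' (Suc i)}" for r
        using q[of "2 * r"] that eq[OF that] by (simp add: ti)
      then show ?thesis unfolding constant_on_def by blast
    qed
    note p = pieces[OF i]
    have "t' i < t' (Suc i)" "s' i \<in> K" using p ti by simp_all
    moreover have "?c ` {t' i..t' (Suc i)} \<subseteq> closed_simplex (s' i)"
      unfolding imgc ti(3) using p by simp
    moreover have "inj_on (f (s' i) \<circ> ?c) {t' i..t' (Suc i)} \<or> (f (s' i) \<circ> ?c) constant_on {t' i..t' (Suc i)}"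
      using p injc constc by blast
    ultimately show ?thesis using img by blast
  qed
  have last: "t' n = 1/2" "t' (Suc n) = 1" "s' n = \<sigma>" using t by (auto simp: t'_def s'_def)
  have new: "?c ` {1/2..1} \<subseteq> closed_simplex \<sigma>" "continuous_on {1/2..1} ?c"
    "inj_on (f \<sigma> \<circ> ?c) {1/2..1} \<or> (f \<sigma> \<circ> ?c) constant_on {1/2..1}"
  proof -
    show "?c ` {1/2..1} \<subseteq> closed_simplex \<sigma>"
      using mix_in_closed_simplex[OF \<sigma>(2,3)] by (auto simp: right)
    have "path ?c" using path path_mix c1 by (intro path_join_imp) (auto simp: pathfinish_def pathstart_def)
    then show "continuous_on {1/2..1} ?c" unfolding path_def by (rule continuous_on_subset) auto
    have val: "(f \<sigma> \<circ> ?c) r = f \<sigma> y + (2 * r - 1) * (f \<sigma> z - f \<sigma> y)" if "r \<in> {1/2..1}" for r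
      using that by (simp add: right fe)
    show "inj_on (f \<sigma> \<circ> ?c) {1/2..1} \<or> (f \<sigma> \<circ> ?c) constant_on {1/2..1}"
    proof (cases "f \<sigma> z = f \<sigma> y")
      case True
      then have "\<forall>r\<in>{1/2..1}. (f \<sigma> \<circ> ?c) r = f \<sigma> y" using val by simp
      then show ?thesis unfolding constant_on_def by blast
    next
      case False
      have "inj_on (f \<sigma> \<circ> ?c) {1/2..1}"
      proof (rule inj_onI)
        fix r r' assume r: "r \<in> {1/2..1}" "r' \<in> {1/2..1}" "(f \<sigma> \<circ> ?c) r = (f \<sigma> \<circ> ?c) r'"
        have "(2 * r - 1) * (f \<sigma> z - f \<sigma> y) = (2 * r' - 1) * (f \<sigma> z - f \<sigma> y)"
          using r(3) unfolding val[OF r(1)] val[OF r(2)] by linarith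
        then show "r = r'" using False by simp
      qed
      then show ?thesis ..
    qed
  qed
  have lastm: "measure lborel ((f \<sigma> \<circ> ?c) ` {1/2..1}) = \<bar>f \<sigma> y - f \<sigma> z\<bar>"
    using measure_of_monotone_piece[OF \<sigma>(1) _ new(2,1,3)] right[of "1/2"] right[of 1] by simp
  show ?thesis
    unfolding has_transverse_measure_def
  proof (intro conjI exI[of _ "Suc n"] exI[of _ t'] exI[of _ s'])
    show "path ?c" using path path_mix c1 by (intro path_join_imp) (auto simp: pathfinish_def pathstart_def)
    show "t' 0 = 0" "t' (Suc n) = 1" using t by (auto simp: t'_def)
    show "\<forall>i<Suc n. t' i < t' (Suc i) \<and> s' i \<in> K \<and> ?c ` {t' i..t' (Suc i)} \<subseteq> closed_simplex (s' i) \<and>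
        (inj_on (f (s' i) \<circ> ?c) {t' i..t' (Suc i)} \<or> (f (s' i) \<circ> ?c) constant_on {t' i..t' (Suc i)})"
    proof (intro allI impI)
      fix i assume "i < Suc n"
      then consider "i < n" | "i = n" by linarith
      then show "t' i < t' (Suc i) \<and> s' i \<in> K \<and> ?c ` {t' i..t' (Suc i)} \<subseteq> closed_simplex (s' i) \<and>
        (inj_on (f (s' i) \<circ> ?c) {t' i..t' (Suc i)} \<or> (f (s' i) \<circ> ?c) constant_on {t' i..t' (Suc i)})"
      proof cases
        case 1 then show ?thesis using old by blast
      next
        case 2
        show ?thesis unfolding 2 last using new(1,3) \<sigma>(1) by simp
      qed
    qed
    have "(\<Sum>i<n. measure lborel ((f (s' i) \<circ> ?c) ` {t' i..t' (Suc i)})) = m"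
      unfolding m by (intro sum.cong) (use old in auto)
    then show "m + \<bar>f \<sigma> y - f \<sigma> z\<bar> =
        (\<Sum>i<Suc n. measure lborel ((f (s' i) \<circ> ?c) ` {t' i..t' (Suc i)}))"
      by (simp only: sum.lessThan_Suc last lastm)
  qed
qed

lemma measured_path_of_chain:
  "chain x y m \<Longrightarrow> \<exists>c. pathstart c = x \<and> pathfinish c = y \<and> has_transverse_measure K f c m"
proof (induction rule: chain.induct)
  case (refl x)
  then show ?case
    using has_transverse_measure_const by (intro exI[of _ "\<lambda>_. x"]) (simp add: pathstart_def pathfinish_def)
next
  case (step x y m \<sigma> z)
  then obtain c where c: "pathstart c = x" "pathfinish c = y" "has_transverse_measure K f c m" by blast
  show ?case
  proof (intro exI conjI)
    show "has_transverse_measure K f (c +++ (\<lambda>u. mix u y z)) (m + \<bar>f \<sigma> y - f \<sigma> z\<bar>)"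
      using has_transverse_measure_append[OF c(3,2)] step.hyps by blast
    show "pathstart (c +++ (\<lambda>u. mix u y z)) = x" using c by simp
    show "pathfinish (c +++ (\<lambda>u. mix u y z)) = z"
      by (simp only: pathfinish_join) (simp add: pathfinish_def)
  qed
qed

text \<open>The measure of a transverse or parallel piece of path is the difference of the
  transverse coordinate at its ends, so paths and chains realize the same values.\<close>

lemma leaf_pseudodist_eq_Inf_chain: "leaf_pseudodist K f x y = Inf {m. chain x y m}"
proof -
  have "{m. \<exists>c. pathstart c = x \<and> pathfinish c = y \<and> has_transverse_measure K f c m} = {m. chain x y m}"
    using chain_of_measured_path measured_path_of_chain by blast
  then show ?thesis by (simp add: leaf_pseudodist_def)
qed

abbreviation "\<delta> \<equiv> leaf_pseudodist K f"

lemma leaf_pseudodist_le: "chain x y m \<Longrightarrow> \<delta> x y \<le> m"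
  unfolding leaf_pseudodist_eq_Inf_chain
  by (intro cInf_lower bdd_belowI[of _ 0]) (auto intro: chain_nonneg)

lemma leaf_pseudodist_approx:
  assumes "x \<in> realization K" "y \<in> realization K" "\<delta> x y < r"
  obtains m where "chain x y m" "m < r"
proof -
  have "{m. chain x y m} \<noteq> {}" using chain_exists[OF assms(1,2)] by simp
  then obtain m where "m \<in> {m. chain x y m}" "m < r"
    using cInf_lessD[of "{m. chain x y m}" r] assms(3) unfolding leaf_pseudodist_eq_Inf_chain by blast
  then show ?thesis using that by simp
qed

lemma leaf_pseudodist_nonneg:
  assumes "x \<in> realization K" "y \<in> realization K"
  shows "0 \<le> \<delta> x y"
  unfolding leaf_pseudodist_eq_Inf_chain
  by (rule cInf_greatest) (use chain_exists[OF assms] chain_nonneg in auto)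

lemma leaf_pseudodist_self: "x \<in> realization K \<Longrightarrow> \<delta> x x = 0"
  using leaf_pseudodist_le[OF chain.refl] leaf_pseudodist_nonneg by (meson antisym)

lemma leaf_pseudodist_commute: "\<delta> x y = \<delta> y x"
proof -
  have "{m. chain x y m} = {m. chain y x m}" using chain_sym by blast
  then show ?thesis by (simp add: leaf_pseudodist_eq_Inf_chain)
qed

lemma leaf_pseudodist_triangle:
  assumes "x \<in> realization K" "y \<in> realization K" "z \<in> realization K"
  shows "\<delta> x z \<le> \<delta> x y + \<delta> y z"
proof (rule field_le_epsilon)
  fix e :: real assume "e > 0"
  then have less: "\<delta> x y < \<delta> x y + e/2" "\<delta> y z < \<delta> y z + e/2" by simp_all
  obtain m where m: "chain x y m" "m < \<delta> x y + e/2"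
    by (rule leaf_pseudodist_approx[OF assms(1,2) less(1)])
  obtain m' where m': "chain y z m'" "m' < \<delta> y z + e/2"
    by (rule leaf_pseudodist_approx[OF assms(2,3) less(2)])
  have "\<delta> x z \<le> m + m'" by (rule leaf_pseudodist_le[OF chain_trans[OF m'(1) m(1)]])
  then show "\<delta> x z \<le> \<delta> x y + \<delta> y z + e" using m(2) m'(2) by linarith
qed

lemma leaf_rel_iff: "(x, y) \<in> leaf_rel K f \<longleftrightarrow> x \<in> realization K \<and> y \<in> realization K \<and> \<delta> x y = 0"
  by (auto simp: leaf_rel_def)

lemma equiv_leaf_rel: "equiv (realization K) (leaf_rel K f)"
proof (rule equivI)
  show "leaf_rel K f \<subseteq> realization K \<times> realization K" by (auto simp: leaf_rel_iff)
  show "refl_on (realization K) (leaf_rel K f)"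
    by (auto simp: refl_on_def leaf_rel_iff leaf_pseudodist_self)
  show "sym (leaf_rel K f)" by (auto simp: sym_def leaf_rel_iff leaf_pseudodist_commute)
  show "trans (leaf_rel K f)"
  proof (rule transI)
    fix x y z assume *: "(x, y) \<in> leaf_rel K f" "(y, z) \<in> leaf_rel K f"
    then have "\<delta> x z \<le> 0" "0 \<le> \<delta> x z"
      using leaf_pseudodist_triangle[of x y z] leaf_pseudodist_nonneg[of x z]
      unfolding leaf_rel_iff by auto
    then show "(x, z) \<in> leaf_rel K f" using * by (simp add: leaf_rel_iff)
  qed
qed

lemma leaf_dist_class:
  assumes x: "x \<in> realization K" and y: "y \<in> realization K"
  shows "leaf_dist K f (leaf_rel K f `` {x}) (leaf_rel K f `` {y}) = \<delta> x y"
proof -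
  define x' where "x' = (SOME z. z \<in> leaf_rel K f `` {x})"
  define y' where "y' = (SOME z. z \<in> leaf_rel K f `` {y})"
  have "x' \<in> leaf_rel K f `` {x}" "y' \<in> leaf_rel K f `` {y}"
    unfolding x'_def y'_def using equiv_class_self[OF equiv_leaf_rel] x y by (metis someI)+
  then have *: "x' \<in> realization K" "\<delta> x x' = 0" "y' \<in> realization K" "\<delta> y y' = 0"
    by (auto simp: leaf_rel_iff)
  have "\<delta> x' y' \<le> \<delta> x y"
    using leaf_pseudodist_triangle[of x' x y'] leaf_pseudodist_triangle[of x y y'] * x y
      leaf_pseudodist_commute[of x x'] by linarith
  moreover have "\<delta> x y \<le> \<delta> x' y'"
    using leaf_pseudodist_triangle[of x x' y] leaf_pseudodist_triangle[of x' y' y] * x y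
      leaf_pseudodist_commute[of y y'] by linarith
  ultimately show ?thesis by (simp add: leaf_dist_def x'_def y'_def)
qed

end


section \<open>Coarsely connected covers of a tree\<close>

lemma isometric_actionD:
  assumes "isometric_action G \<alpha>"
  shows "group G"
    and "g \<in> carrier G \<Longrightarrow> h \<in> carrier G \<Longrightarrow> \<alpha> (g \<otimes>\<^bsub>G\<^esub> h) x = \<alpha> g (\<alpha> h x)"
    and "g \<in> carrier G \<Longrightarrow> \<alpha> (inv\<^bsub>G\<^esub> g) (\<alpha> g x) = x"
    and "g \<in> carrier G \<Longrightarrow> \<alpha> g (\<alpha> (inv\<^bsub>G\<^esub> g) x) = x"
    and "g \<in> carrier G \<Longrightarrow> dist (\<alpha> g x) (\<alpha> g y) = dist x y"
proof -
  have act: "group_action G UNIV \<alpha>" and iso: "\<And>g. g \<in> carrier G \<Longrightarrow> isometry (\<alpha> g)"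
    using assms by (auto simp: isometric_action_def)
  show grp: "group G"
    using group_action.group_hom[OF act] by (simp add: group_hom_def)
  show "\<alpha> (g \<otimes>\<^bsub>G\<^esub> h) x = \<alpha> g (\<alpha> h x)" if "g \<in> carrier G" "h \<in> carrier G"
    using group_action.composition_rule[OF act _ that] by simp
  show inv: "\<alpha> (inv\<^bsub>G\<^esub> g) (\<alpha> g x) = x" if "g \<in> carrier G" for g x
    using group_action.orbit_sym_aux[OF act that] by simp
  show "\<alpha> g (\<alpha> (inv\<^bsub>G\<^esub> g) x) = x" if "g \<in> carrier G"
    using inv[of "inv\<^bsub>G\<^esub> g" x] that grp by (simp add: group.inv_inv)
  show "dist (\<alpha> g x) (\<alpha> g y) = dist x y" if "g \<in> carrier G"
    using iso[OF that] by (simp add: isometry_def)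
qed

lemma connected_translate:
  assumes "isometric_action G \<alpha>" "g \<in> carrier G" "connected S"
  shows "connected (\<alpha> g ` S)"
proof (rule connected_continuous_image[OF _ assms(3)])
  show "continuous_on S (\<alpha> g)"
    unfolding continuous_on_iff using isometric_actionD(5)[OF assms(1,2)] by auto
qed

definition cover_step ::
    "('g, 'm) monoid_scheme \<Rightarrow> ('g \<Rightarrow> 'a \<Rightarrow> 'a) \<Rightarrow> 'a set \<Rightarrow> 'g set \<Rightarrow> 'a set \<Rightarrow> ('g \<times> 'g) set" where
  "cover_step G \<alpha> P N U =
     {(g, k). g \<in> carrier G \<and> k \<in> carrier G \<and> inv\<^bsub>G\<^esub> g \<otimes>\<^bsub>G\<^esub> k \<in> N \<and>
        \<alpha> g ` P \<inter> U \<noteq> {} \<and> \<alpha> k ` P \<inter> U \<noteq> {}}"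

text \<open>All that is used of a geometric action on \<open>T\<close>. The translates of \<open>P\<close> cover \<open>T\<close>, finitely
  many of them suffice along any segment, and over every connected open set \<open>U\<close> the translates
  that meet \<open>U\<close> are linked to each other by right multiplications by elements of the finite set
  \<open>N\<close>. The last clause is a discrete substitute for the connectedness of the preimage of \<open>U\<close> in
  the foliated complex, and it makes sense without the complex, so that it can be confronted with
  another action of \<open>G\<close>.\<close>

definition coarsely_connected_cover ::
    "('g, 'm) monoid_scheme \<Rightarrow> ('g \<Rightarrow> 'a::metric_space \<Rightarrow> 'a) \<Rightarrow> 'a set \<Rightarrow> 'g set \<Rightarrow> bool" where
  "coarsely_connected_cover G \<alpha> P N \<longleftrightarrow>
     segment_union P \<and> finite N \<and> N \<subseteq> carrier G \<and>
     (\<forall>x. \<exists>g\<in>carrier G. x \<in> \<alpha> g ` P) \<and>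
     (\<forall>x y. \<exists>C S. finite C \<and> C \<subseteq> carrier G \<and> connected S \<and> x \<in> S \<and> y \<in> S \<and> S \<subseteq> (\<Union>c\<in>C. \<alpha> c ` P)) \<and>
     (\<forall>U g k. open U \<longrightarrow> connected U \<longrightarrow> g \<in> carrier G \<longrightarrow> k \<in> carrier G \<longrightarrow>
        \<alpha> g ` P \<inter> U \<noteq> {} \<longrightarrow> \<alpha> k ` P \<inter> U \<noteq> {} \<longrightarrow> (g, k) \<in> (cover_step G \<alpha> P N U)\<^sup>*)"

text \<open>The trace in a second tree of the part of the group that lies over \<open>U\<close> in the first one.
  It replaces the image of the preimage of \<open>U\<close> under an equivariant map from the foliated complex
  to the second tree.\<close>

definition translates_over ::
    "('g, 'm) monoid_scheme \<Rightarrow> ('g \<Rightarrow> 'a \<Rightarrow> 'a) \<Rightarrow> 'a set \<Rightarrow> 'a set \<Rightarrow> ('g \<Rightarrow> 'b \<Rightarrow> 'b) \<Rightarrow> 'b set \<Rightarrow> 'b set" where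
  "translates_over G \<alpha> P U \<beta> E = (\<Union>k\<in>{k \<in> carrier G. \<alpha> k ` P \<inter> U \<noteq> {}}. \<beta> k ` E)"

text \<open>If \<open>E\<close> contains \<open>e\<close> and \<open>\<beta> n e\<close> for all \<open>n\<close> in \<open>N\<close>, then translates of \<open>E\<close> by elements
  one step apart intersect.\<close>

lemma connected_translates_over:
  assumes cover: "coarsely_connected_cover G \<alpha> P N" and act: "isometric_action G \<beta>"
    and E: "connected E" "e \<in> E" "\<And>n. n \<in> N \<Longrightarrow> \<beta> n e \<in> E"
    and U: "open U" "connected U"
  shows "connected (translates_over G \<alpha> P U \<beta> E)"
proof -
  define H where "H = {k \<in> carrier G. \<alpha> k ` P \<inter> U \<noteq> {}}"
  interpret group G by (rule isometric_actionD(1)[OF act])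
  have N: "N \<subseteq> carrier G" using cover by (simp add: coarsely_connected_cover_def)
  have path: "\<exists>M. connected M \<and> \<beta> g ` E \<subseteq> M \<and> \<beta> k ` E \<subseteq> M \<and> M \<subseteq> (\<Union>l\<in>H. \<beta> l ` E)"
    if g: "g \<in> H" and "(g, k) \<in> (cover_step G \<alpha> P N U)\<^sup>*" for g k
    using that(2)
  proof (induction rule: rtrancl_induct)
    case base
    show ?case
      using g connected_translate[OF act _ E(1), of g] by (intro exI[of _ "\<beta> g ` E"]) (auto simp: H_def)
  next
    case (step k l)
    then obtain M where M: "connected M" "\<beta> g ` E \<subseteq> M" "\<beta> k ` E \<subseteq> M" "M \<subseteq> (\<Union>l\<in>H. \<beta> l ` E)"
      by blast
    have kl: "k \<in> carrier G" "l \<in> carrier G" "inv\<^bsub>G\<^esub> k \<otimes>\<^bsub>G\<^esub> l \<in> N" "l \<in> H"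
      using step.hyps(2) by (auto simp: cover_step_def H_def)
    have "k \<otimes>\<^bsub>G\<^esub> (inv\<^bsub>G\<^esub> k \<otimes>\<^bsub>G\<^esub> l) = l" using kl by (simp add: m_assoc[symmetric])
    then have "\<beta> l e = \<beta> k (\<beta> (inv\<^bsub>G\<^esub> k \<otimes>\<^bsub>G\<^esub> l) e)"
      using isometric_actionD(2)[OF act kl(1), of "inv\<^bsub>G\<^esub> k \<otimes>\<^bsub>G\<^esub> l" e] kl N by auto
    then have "\<beta> l e \<in> \<beta> k ` E" using E(3)[OF kl(3)] by simp
    then have "connected (M \<union> \<beta> l ` E)"
      using M(1,3) E(2) connected_translate[OF act kl(2) E(1)] by (intro connected_Un) auto
    then show ?case
      using M kl(4) by (intro exI[of _ "M \<union> \<beta> l ` E"]) auto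
  qed
  show ?thesis
  proof (cases "H = {}")
    case True
    then show ?thesis by (simp add: translates_over_def H_def[symmetric])
  next
    case False
    then obtain g where g: "g \<in> H" by blast
    have "\<exists>M. connected M \<and> \<beta> g ` E \<subseteq> M \<and> \<beta> k ` E \<subseteq> M \<and> M \<subseteq> (\<Union>l\<in>H. \<beta> l ` E)" if "k \<in> H" for k
    proof (rule path[OF g])
      show "(g, k) \<in> (cover_step G \<alpha> P N U)\<^sup>*"
        using cover U g that unfolding coarsely_connected_cover_def H_def by simp
    qed
    then obtain M where M: "\<And>k. k \<in> H \<Longrightarrow> connected (M k) \<and> \<beta> g ` E \<subseteq> M k \<and> \<beta> k ` E \<subseteq> M k \<and>
        M k \<subseteq> (\<Union>l\<in>H. \<beta> l ` E)"
      by metis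
    have "connected (\<Union>k\<in>H. M k)"
    proof (rule connected_Union)
      have "\<beta> g e \<in> \<Inter> (M ` H)" using M E(2) by blast
      then show "\<Inter> (M ` H) \<noteq> {}" by blast
    qed (use M in blast)
    moreover have "(\<Union>k\<in>H. M k) = (\<Union>l\<in>H. \<beta> l ` E)"
    proof (intro equalityI UN_least)
      fix k assume "k \<in> H"
      then show "M k \<subseteq> (\<Union>l\<in>H. \<beta> l ` E)" "\<beta> k ` E \<subseteq> (\<Union>k\<in>H. M k)" using M by blast+
    qed
    ultimately show ?thesis by (simp add: translates_over_def H_def[symmetric])
  qed
qed

lemma segment_union_finite_cover:
  fixes \<alpha> :: "'g \<Rightarrow> 'a::real_tree \<Rightarrow> 'a"
  assumes cover: "coarsely_connected_cover G \<alpha> P N" and Q: "segment_union Q"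
  obtains C where "finite C" "C \<subseteq> carrier G" "Q \<subseteq> (\<Union>c\<in>C. \<alpha> c ` P)"
proof -
  obtain \<I> where \<I>: "finite \<I>" "\<And>I. I \<in> \<I> \<Longrightarrow> compact_segment I" "Q = \<Union>\<I>"
    using Q unfolding segment_union_def by auto
  have "\<exists>C. finite C \<and> C \<subseteq> carrier G \<and> I \<subseteq> (\<Union>c\<in>C. \<alpha> c ` P)" if I: "I \<in> \<I>" for I
  proof -
    obtain l \<gamma> where \<gamma>: "geodesic_on l \<gamma>" "I = \<gamma> ` {0..l}"
      using \<I>(2)[OF I] unfolding compact_segment_def by blast
    obtain C S where CS: "finite C" "C \<subseteq> carrier G" "connected S" "\<gamma> 0 \<in> S" "\<gamma> l \<in> S"
      "S \<subseteq> (\<Union>c\<in>C. \<alpha> c ` P)"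
      using cover unfolding coarsely_connected_cover_def by meson
    have "I \<subseteq> S" unfolding \<gamma>(2) by (rule geodesic_subset_connected[OF \<gamma>(1) CS(3-5)])
    then have "I \<subseteq> (\<Union>c\<in>C. \<alpha> c ` P)" using CS(6) by (rule subset_trans)
    with CS(1,2) show ?thesis by (intro exI[of _ C] conjI)
  qed
  then obtain C where C: "\<And>I. I \<in> \<I> \<Longrightarrow> finite (C I) \<and> C I \<subseteq> carrier G \<and> I \<subseteq> (\<Union>c\<in>C I. \<alpha> c ` P)"
    by metis
  show ?thesis
  proof (rule that)
    show "finite (\<Union>I\<in>\<I>. C I)" "(\<Union>I\<in>\<I>. C I) \<subseteq> carrier G" using C \<I>(1) by blast+
    show "Q \<subseteq> (\<Union>c\<in>(\<Union>I\<in>\<I>. C I). \<alpha> c ` P)"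
      unfolding \<I>(3)
    proof (rule Union_least)
      fix I assume "I \<in> \<I>"
      then show "I \<subseteq> (\<Union>c\<in>(\<Union>I\<in>\<I>. C I). \<alpha> c ` P)" using C[of I] by blast
    qed
  qed
qed


section \<open>Geometric actions have coarsely connected covers\<close>

locale dual_action = foliated_complex K f
  for K :: "'v set set" and f +
  fixes G :: "('g, 'm) monoid_scheme" and \<alpha> :: "'g \<Rightarrow> 'a::real_tree \<Rightarrow> 'a"
    and \<rho> :: "'g \<Rightarrow> ('v \<Rightarrow> real) \<Rightarrow> ('v \<Rightarrow> real)" and h :: "'a \<Rightarrow> ('v \<Rightarrow> real) set"
  assumes action: "isometric_action G \<alpha>"
    and simplicial: "simplicial_action G K \<rho>"
    and proper: "properly_discontinuous_action G (weak_topology K) \<rho>"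
    and cocompact: "cocompact_action G (weak_topology K) \<rho>"
    and bij_h: "bij_betw h UNIV (leaf_space K f)"
    and isometry_h: "leaf_dist K f (h x) (h y) = dist x y"
    and equivariant_h: "g \<in> carrier G \<Longrightarrow> h (\<alpha> g x) = \<rho> g ` h x"
    and transverse: "transverse_edge K f e \<Longrightarrow> z \<in> closed_simplex e \<Longrightarrow> w \<in> closed_simplex e \<Longrightarrow>
      leaf_dist K f (leaf_rel K f `` {z}) (leaf_rel K f `` {w}) = dist (f e z) (f e w)"
begin

definition leaf_map :: "('v \<Rightarrow> real) \<Rightarrow> 'a" where
  "leaf_map z = inv_into UNIV h (leaf_rel K f `` {z})"

lemma h_leaf_map: "z \<in> realization K \<Longrightarrow> h (leaf_map z) = leaf_rel K f `` {z}"
  unfolding leaf_map_def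
  by (rule bij_betw_inv_into_right[OF bij_h]) (simp add: leaf_space_def quotientI)

lemma dist_leaf_map:
  assumes "z \<in> realization K" "w \<in> realization K"
  shows "dist (leaf_map z) (leaf_map w) = \<delta> z w"
  using isometry_h[of "leaf_map z" "leaf_map w"] by (simp add: h_leaf_map leaf_dist_class assms)

lemma leaf_map_eqI:
  assumes "z \<in> h x"
  shows "leaf_map z = x" "z \<in> realization K"
proof -
  have "h x \<in> leaf_space K f" using bij_h by (auto simp: bij_betw_def)
  then obtain w where w: "w \<in> realization K" "h x = leaf_rel K f `` {w}"
    unfolding leaf_space_def by (rule quotientE)
  then have wz: "(w, z) \<in> leaf_rel K f" using assms by simp
  then show z: "z \<in> realization K" by (simp add: leaf_rel_iff)
  have "h (leaf_map z) = h x"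
    unfolding h_leaf_map[OF z] w(2) using equiv_class_eq[OF equiv_leaf_rel wz] by simp
  then show "leaf_map z = x" using bij_h by (auto simp: bij_betw_def inj_on_def)
qed

lemma leaf_map_surj: obtains z where "z \<in> realization K" "leaf_map z = x"
proof -
  have "h x \<in> leaf_space K f" using bij_h by (auto simp: bij_betw_def)
  then obtain w where w: "w \<in> realization K" "h x = leaf_rel K f `` {w}"
    unfolding leaf_space_def by (rule quotientE)
  then have "w \<in> h x" using equiv_class_self[OF equiv_leaf_rel] by simp
  then show ?thesis using that w(1) leaf_map_eqI by blast
qed

lemma leaf_map_equivariant:
  assumes g: "g \<in> carrier G" and z: "z \<in> realization K"
  shows "leaf_map (\<rho> g z) = \<alpha> g (leaf_map z)"
proof (rule leaf_map_eqI)
  have "z \<in> h (leaf_map z)" using h_leaf_map[OF z] equiv_class_self[OF equiv_leaf_rel z] by simp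
  then show "\<rho> g z \<in> h (\<alpha> g (leaf_map z))" using equivariant_h[OF g] by simp
qed

lemma leaf_map_step:
  assumes "\<sigma> \<in> K" "y \<in> closed_simplex \<sigma>" "z \<in> closed_simplex \<sigma>"
  shows "dist (leaf_map y) (leaf_map z) \<le> \<bar>f \<sigma> y - f \<sigma> z\<bar>"
proof -
  have "y \<in> realization K" "z \<in> realization K"
    using closed_simplex_subset_realization assms by auto
  then show ?thesis
    using leaf_pseudodist_le[OF chain_simplex[OF assms]] by (simp add: dist_leaf_map)
qed

lemma leaf_map_edge:
  assumes \<sigma>: "\<sigma> \<in> K" and vw: "v \<in> \<sigma>" "w \<in> \<sigma>" and ne: "f \<sigma> (vertex v) \<noteq> f \<sigma> (vertex w)"
    and yz: "y \<in> closed_simplex {v, w}" "z \<in> closed_simplex {v, w}"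
  shows "dist (leaf_map y) (leaf_map z) = \<bar>f \<sigma> y - f \<sigma> z\<bar>"
proof -
  let ?e = "{v, w}"
  have e: "?e \<in> K" by (rule face_in_complex[OF \<sigma>]) (use vw in auto)
  have sub: "?e \<subseteq> \<sigma>" using vw by simp
  have "\<exists>\<phi>::real \<Rightarrow> real. isometry \<phi> \<and> (\<forall>x\<in>closed_simplex ?e. f ?e x = \<phi> (f \<sigma> x))"
    using foliation \<sigma> e sub unfolding measured_foliation_def by simp
  then obtain \<phi> :: "real \<Rightarrow> real" where \<phi>: "isometry \<phi>" "\<And>x. x \<in> closed_simplex ?e \<Longrightarrow> f ?e x = \<phi> (f \<sigma> x)"
    by blast
  then have fe: "dist (f ?e x) (f ?e x') = \<bar>f \<sigma> x - f \<sigma> x'\<bar>"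
    if "x \<in> closed_simplex ?e" "x' \<in> closed_simplex ?e" for x x'
    using that unfolding isometry_def by (simp add: dist_real_def)
  have "vertex v \<in> closed_simplex ?e" "vertex w \<in> closed_simplex ?e"
    by (simp_all add: vertex_in_closed_simplex)
  then have "f ?e (vertex v) \<noteq> f ?e (vertex w)" using fe[of "vertex v" "vertex w"] ne by auto
  then have "\<not> f ?e constant_on closed_simplex ?e"
    using \<open>vertex v \<in> closed_simplex ?e\<close> \<open>vertex w \<in> closed_simplex ?e\<close>
    unfolding constant_on_def by metis
  moreover have "card ?e = 2" using ne by (auto simp: card_2_iff)
  ultimately have "transverse_edge K f ?e" using e by (simp add: transverse_edge_def)
  note tr = transverse[OF this yz]
  have "y \<in> realization K" "z \<in> realization K"
    using closed_simplex_subset_realization[OF e] yz by auto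
  then show ?thesis using tr fe[OF yz] by (simp add: leaf_dist_class dist_leaf_map)
qed

text \<open>The transverse coordinate on a simplex takes all its values on the edge joining a lowest
  to a highest vertex, and points with the same coordinate have the same image. Either the
  coordinate is constant, and the image is a point, or this edge is transverse and therefore
  embeds isometrically.\<close>

lemma compact_segment_leaf_map_simplex:
  assumes \<sigma>: "\<sigma> \<in> K"
  shows "compact_segment (leaf_map ` closed_simplex \<sigma>)"
proof -
  define F where "F v = f \<sigma> (vertex v)" for v
  have fin: "finite \<sigma>" and ne: "\<sigma> \<noteq> {}"
    using complex \<sigma> by (auto simp: simplicial_2_complex_def)
  have F: "finite (F ` \<sigma>)" "F ` \<sigma> \<noteq> {}" using fin ne by auto
  obtain v where v: "v \<in> \<sigma>" "F v = Min (F ` \<sigma>)" using Min_in[OF F] by auto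
  obtain w where w: "w \<in> \<sigma>" "F w = Max (F ` \<sigma>)" using Max_in[OF F] by auto
  have min: "F v \<le> F u" if "u \<in> \<sigma>" for u using Min_le[OF F(1), of "F u"] that v by simp
  have max: "F u \<le> F w" if "u \<in> \<sigma>" for u using Max_ge[OF F(1), of "F u"] that w by simp
  have bounds: "F v \<le> f \<sigma> z" "f \<sigma> z \<le> F w" if z: "z \<in> closed_simplex \<sigma>" for z
    using affine_on_simplex_bounds[OF foliation_eq_sum[OF \<sigma> z] z] min max by (auto simp: F_def)
  have vert: "vertex v \<in> closed_simplex \<sigma>" "vertex w \<in> closed_simplex \<sigma>"
    using vertex_in_closed_simplex[OF fin] v w by auto
  show ?thesis
  proof (cases "F v = F w")
    case True
    have "leaf_map z = leaf_map (vertex v)" if z: "z \<in> closed_simplex \<sigma>" for z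
    proof -
      have "f \<sigma> z = f \<sigma> (vertex v)" using bounds[OF z] True by (simp add: F_def)
      then show ?thesis using leaf_map_step[OF \<sigma> z vert(1)] by simp
    qed
    then have "leaf_map ` closed_simplex \<sigma> = {leaf_map (vertex v)}" using vert(1) by blast
    then show ?thesis by (simp add: compact_segment_singleton)
  next
    case False
    then have lt: "F v < F w" using min[OF w(1)] by simp
    define l where "l = F w - F v"
    have l: "l > 0" using lt by (simp add: l_def)
    define m where "m t = mix (t / l) (vertex v) (vertex w)" for t
    have me: "m t \<in> closed_simplex {v, w}" if "t \<in> {0..l}" for t
      unfolding m_def using that l by (intro mix_in_closed_simplex vertex_in_closed_simplex) auto
    have sub: "closed_simplex {v, w} \<subseteq> closed_simplex \<sigma>"
      using v w fin by (intro closed_simplex_mono) auto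
    have fm: "f \<sigma> (m t) = F v + t" if "t \<in> {0..l}" for t
    proof -
      have "f \<sigma> (m t) = (1 - t / l) * F v + t / l * F w"
        unfolding m_def F_def using that l by (intro foliation_affine[OF \<sigma> vert]) auto
      also have "\<dots> = F v + t / l * l" unfolding l_def by algebra
      finally show ?thesis using l by simp
    qed
    have "geodesic_on l (\<lambda>t. leaf_map (m t))"
      unfolding geodesic_on_def
    proof (intro conjI ballI)
      fix s t assume st: "s \<in> {0..l}" "t \<in> {0..l}"
      have "dist (leaf_map (m s)) (leaf_map (m t)) = \<bar>f \<sigma> (m s) - f \<sigma> (m t)\<bar>"
        using False by (intro leaf_map_edge[OF \<sigma> v(1) w(1) _ me[OF st(1)] me[OF st(2)]]) (simp add: F_def)
      then show "dist (leaf_map (m s)) (leaf_map (m t)) = \<bar>s - t\<bar>"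
        by (simp add: fm[OF st(1)] fm[OF st(2)])
    qed (use l in simp)
    moreover have "leaf_map ` closed_simplex \<sigma> = (\<lambda>t. leaf_map (m t)) ` {0..l}"
    proof (intro equalityI image_subsetI)
      fix z assume z: "z \<in> closed_simplex \<sigma>"
      define t where "t = f \<sigma> z - F v"
      have t: "t \<in> {0..l}" using bounds[OF z] by (simp add: t_def l_def)
      then have "f \<sigma> (m t) = f \<sigma> z" by (simp add: fm) (simp add: t_def)
      then have "leaf_map z = leaf_map (m t)"
        using leaf_map_step[OF \<sigma> z, of "m t"] me[OF t] sub by auto
      then show "leaf_map z \<in> (\<lambda>t. leaf_map (m t)) ` {0..l}" using t by blast
    next
      fix t assume "t \<in> {0..l}"
      then show "leaf_map (m t) \<in> leaf_map ` closed_simplex \<sigma>" using me sub by blast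
    qed
    ultimately show ?thesis unfolding compact_segment_def by blast
  qed
qed

lemma action_complex:
  assumes "z \<in> realization K" "g \<in> carrier G" "k \<in> carrier G"
  shows "\<rho> g z \<in> realization K" "\<rho> (g \<otimes>\<^bsub>G\<^esub> k) z = \<rho> g (\<rho> k z)" "\<rho> (inv\<^bsub>G\<^esub> g) (\<rho> g z) = z"
proof -
  have act: "group_action G (realization K) \<rho>" using simplicial by (simp add: simplicial_action_def)
  show "\<rho> g z \<in> realization K" using group_action.element_image[OF act] assms by blast
  show "\<rho> (g \<otimes>\<^bsub>G\<^esub> k) z = \<rho> g (\<rho> k z)" by (rule group_action.composition_rule[OF act assms])
  show "\<rho> (inv\<^bsub>G\<^esub> g) (\<rho> g z) = z"
    using group_action.orbit_sym_aux[OF act assms(2,1)] by simp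
qed

text \<open>A compact set whose translates cover meets only finitely many open simplices.\<close>

lemma finite_fundamental_subcomplex:
  obtains \<Phi> where "finite \<Phi>" "\<Phi> \<subseteq> K"
    "\<forall>\<tau>\<in>K. \<exists>g\<in>carrier G. closed_simplex \<tau> \<subseteq> \<rho> g ` (\<Union>\<sigma>\<in>\<Phi>. closed_simplex \<sigma>)"
proof -
  obtain C where C: "compactin (weak_topology K) C" "(\<Union>g\<in>carrier G. \<rho> g ` C) = realization K"
    using cocompact unfolding cocompact_action_def topspace_weak_topology by blast
  obtain \<Phi> where \<Phi>: "finite \<Phi>" "\<Phi> \<subseteq> K" "C \<subseteq> (\<Union>\<sigma>\<in>\<Phi>. closed_simplex \<sigma>)"
    by (rule compactin_subset_finite_simplices[OF complex C(1)])
  have "\<exists>g\<in>carrier G. closed_simplex \<tau> \<subseteq> \<rho> g ` (\<Union>\<sigma>\<in>\<Phi>. closed_simplex \<sigma>)" if \<tau>: "\<tau> \<in> K" for \<tau>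
  proof -
    have fin: "finite \<tau>" "\<tau> \<noteq> {}" using complex \<tau> by (auto simp: simplicial_2_complex_def)
    \<comment> \<open>A simplex that contains the barycentre of \<open>\<tau>\<close> contains \<open>\<tau>\<close>.\<close>
    define z where "z v = (if v \<in> \<tau> then 1 / real (card \<tau>) else 0)" for v
    have "z \<in> closed_simplex \<tau>" using fin by (simp add: z_def closed_simplex_def)
    then have "z \<in> (\<Union>g\<in>carrier G. \<rho> g ` C)"
      unfolding C(2) using closed_simplex_subset_realization[OF \<tau>] by blast
    then obtain g c where g: "g \<in> carrier G" "c \<in> C" "z = \<rho> g c" by blast
    then obtain \<sigma> where \<sigma>: "\<sigma> \<in> \<Phi>" "c \<in> closed_simplex \<sigma>" using \<Phi>(3) by blast
    then obtain \<sigma>' where \<sigma>': "\<sigma>' \<in> K" "\<rho> g ` closed_simplex \<sigma> = closed_simplex \<sigma>'"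
      using simplicial g(1) \<Phi>(2) unfolding simplicial_action_def by blast
    have "z \<in> closed_simplex \<sigma>'" unfolding \<sigma>'(2)[symmetric] using g(3) \<sigma>(2) by blast
    have "\<tau> \<subseteq> \<sigma>'"
    proof
      fix v assume "v \<in> \<tau>"
      then have "z v \<noteq> 0" using fin by (simp add: z_def)
      then show "v \<in> \<sigma>'" using \<open>z \<in> closed_simplex \<sigma>'\<close> unfolding closed_simplex_def by blast
    qed
    then have "closed_simplex \<tau> \<subseteq> \<rho> g ` closed_simplex \<sigma>"
      unfolding \<sigma>'(2) using finite_simplex[OF \<sigma>'(1)] by (rule closed_simplex_mono)
    then show ?thesis using g(1) \<sigma>(1) by blast
  qed
  then show ?thesis by (intro that[OF \<Phi>(1,2)] ballI)
qed

text \<open>The symmetric relation from which the steps of a cover arise: by proper discontinuity,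
  if \<open>F\<close> is compact, two related elements differ by one of finitely many elements of the group.\<close>

definition overlap :: "('v \<Rightarrow> real) set \<Rightarrow> 'a set \<Rightarrow> ('g \<times> 'g) set" where
  "overlap F U = {(g, k). g \<in> carrier G \<and> k \<in> carrier G \<and>
     (\<exists>z\<in>realization K. leaf_map z \<in> U \<and> z \<in> \<rho> g ` F \<and> z \<in> \<rho> k ` F)}"

lemma sym_overlap: "sym (overlap F U)"
  by (auto simp: sym_def overlap_def)

lemma overlap_mono: "U \<subseteq> V \<Longrightarrow> overlap F U \<subseteq> overlap F V"
  by (auto simp: overlap_def)

context
  fixes F :: "('v \<Rightarrow> real) set"
  assumes F: "\<And>\<tau>. \<tau> \<in> K \<Longrightarrow> \<exists>g\<in>carrier G. closed_simplex \<tau> \<subseteq> \<rho> g ` F"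
begin

lemma translate_containing:
  assumes "z \<in> realization K"
  obtains g where "g \<in> carrier G" "z \<in> \<rho> g ` F"
  using assms F unfolding realization_def by blast

text \<open>A chain of cost less than \<open>r\<close> never leaves the preimage of the ball of radius \<open>r\<close>, and
  each of its steps takes place inside one translate of \<open>F\<close>.\<close>

lemma chain_overlap:
  assumes "chain x y m" "m < r" "g \<in> carrier G" "x \<in> \<rho> g ` F" "k \<in> carrier G" "y \<in> \<rho> k ` F"
  shows "(g, k) \<in> (overlap F (ball (leaf_map x) r))\<^sup>*"
  using assms
proof (induction arbitrary: k rule: chain.induct)
  case (refl x)
  then have "leaf_map x \<in> ball (leaf_map x) r" by simp
  then have "(g, k) \<in> overlap F (ball (leaf_map x) r)"
    unfolding overlap_def using refl by blast
  then show ?case by (rule r_into_rtrancl)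
next
  case (step x y m \<sigma> z)
  note chain' = chain.step[OF step.hyps(1-4)]
  have real: "x \<in> realization K" "y \<in> realization K" "z \<in> realization K"
    using chain_realization[OF step.hyps(1)] chain_realization[OF chain'] by auto
  have less: "m < r" using step.prems(1) by linarith
  have y: "leaf_map y \<in> ball (leaf_map x) r"
    using leaf_pseudodist_le[OF step.hyps(1)] less by (simp add: dist_leaf_map real)
  have z: "leaf_map z \<in> ball (leaf_map x) r"
    using leaf_pseudodist_le[OF chain'] step.prems(1) by (simp add: dist_leaf_map real)
  obtain l where l: "l \<in> carrier G" "closed_simplex \<sigma> \<subseteq> \<rho> l ` F" using F[OF step.hyps(2)] by blast
  have "(g, l) \<in> (overlap F (ball (leaf_map x) r))\<^sup>*"
    using step.IH[OF less step.prems(2,3) l(1)] l(2) step.hyps(3) by blast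
  moreover have "(l, k) \<in> overlap F (ball (leaf_map x) r)"
    unfolding overlap_def using l step.prems(4,5) step.hyps(4) z real by blast
  ultimately show ?case by (rule rtrancl_into_rtrancl)
qed

text \<open>Over balls this is the definition of the leaf distance, since points at distance less
  than \<open>r\<close> are joined by a chain of cost less than \<open>r\<close>. Being linked over \<open>U\<close> is thus a locally
  constant property on \<open>U\<close>. Working with balls avoids any discussion of individual leaves, whose
  closures may be identified in the Hausdorff quotient.\<close>

lemma connected_overlap:
  assumes U: "open U" "connected U"
    and y: "y \<in> realization K" "leaf_map y \<in> U" "g \<in> carrier G" "y \<in> \<rho> g ` F"
    and z: "z \<in> realization K" "leaf_map z \<in> U" "k \<in> carrier G" "z \<in> \<rho> k ` F"
  shows "(g, k) \<in> (overlap F U)\<^sup>*"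
proof -
  define R where "R u u' \<longleftrightarrow> (\<forall>y z g k. y \<in> realization K \<and> leaf_map y = u \<and> g \<in> carrier G \<and> y \<in> \<rho> g ` F \<and>
      z \<in> realization K \<and> leaf_map z = u' \<and> k \<in> carrier G \<and> z \<in> \<rho> k ` F \<longrightarrow> (g, k) \<in> (overlap F U)\<^sup>*)"
    for u u'
  have "R (leaf_map y) (leaf_map z)"
  proof (rule connected_equivalence_relation[OF U(2) y(2) z(2)])
    fix u u' assume R: "R u u'"
    show "R u' u"
      unfolding R_def
    proof (intro allI impI, elim conjE)
      fix y z g k
      assume y: "y \<in> realization K" "leaf_map y = u'" "g \<in> carrier G" "y \<in> \<rho> g ` F"
        and z: "z \<in> realization K" "leaf_map z = u" "k \<in> carrier G" "z \<in> \<rho> k ` F"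
      have "(k, g) \<in> (overlap F U)\<^sup>*" using R y z unfolding R_def by blast
      then show "(g, k) \<in> (overlap F U)\<^sup>*" by (rule symD[OF sym_rtrancl[OF sym_overlap]])
    qed
  next
    fix u u' u'' assume R: "R u u'" "R u' u''"
    obtain w where w: "w \<in> realization K" "leaf_map w = u'" by (rule leaf_map_surj)
    obtain l where l: "l \<in> carrier G" "w \<in> \<rho> l ` F" by (rule translate_containing[OF w(1)])
    show "R u u''"
      unfolding R_def
    proof (intro allI impI, elim conjE)
      fix y z g k
      assume y: "y \<in> realization K" "leaf_map y = u" "g \<in> carrier G" "y \<in> \<rho> g ` F"
        and z: "z \<in> realization K" "leaf_map z = u''" "k \<in> carrier G" "z \<in> \<rho> k ` F"
      have "(g, l) \<in> (overlap F U)\<^sup>*" using R(1) y w l unfolding R_def by blast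
      moreover have "(l, k) \<in> (overlap F U)\<^sup>*" using R(2) w l z unfolding R_def by blast
      ultimately show "(g, k) \<in> (overlap F U)\<^sup>*" by (rule rtrancl_trans)
    qed
  next
    fix u assume "u \<in> U"
    then obtain r where r: "r > 0" "ball u r \<subseteq> U" using U(1) open_contains_ball by blast
    have "R u u'" if u': "u' \<in> ball u r" for u'
      unfolding R_def
    proof (intro allI impI, elim conjE)
      fix y z g k
      assume y: "y \<in> realization K" "leaf_map y = u" "g \<in> carrier G" "y \<in> \<rho> g ` F"
        and z: "z \<in> realization K" "leaf_map z = u'" "k \<in> carrier G" "z \<in> \<rho> k ` F"
      have "\<delta> y z < r" using dist_leaf_map[OF y(1) z(1)] y(2) z(2) u' by simp
      then obtain m where m: "chain y z m" "m < r" by (rule leaf_pseudodist_approx[OF y(1) z(1)])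
      have "(g, k) \<in> (overlap F (ball u r))\<^sup>*"
        using chain_overlap[OF m y(3,4) z(3,4)] y(2) by simp
      then show "(g, k) \<in> (overlap F U)\<^sup>*"
        using rtrancl_mono[OF overlap_mono[OF r(2)]] by blast
    qed
    moreover have "openin (top_of_set U) (ball u r)"
      using r(2) by (intro open_subset) auto
    moreover have "u \<in> ball u r" using r(1) by simp
    ultimately show "\<exists>T. openin (top_of_set U) T \<and> u \<in> T \<and> (\<forall>x\<in>T. R u x)" by blast
  qed
  then show ?thesis using y z unfolding R_def by blast
qed

end

text \<open>The image of a chain of simplices is connected and is covered by one translate per
  simplex.\<close>

lemma chain_finite_cover:
  assumes F: "\<And>\<tau>. \<tau> \<in> K \<Longrightarrow> \<exists>g\<in>carrier G. closed_simplex \<tau> \<subseteq> \<rho> g ` F"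
    and FK: "F \<subseteq> realization K"
    and "chain x y m"
  shows "\<exists>C S. finite C \<and> C \<subseteq> carrier G \<and> connected S \<and> leaf_map x \<in> S \<and> leaf_map y \<in> S \<and>
    S \<subseteq> (\<Union>c\<in>C. \<alpha> c ` leaf_map ` F)"
proof -
  have simplex: "\<exists>c\<in>carrier G. leaf_map ` closed_simplex \<sigma> \<subseteq> \<alpha> c ` leaf_map ` F" if \<sigma>: "\<sigma> \<in> K" for \<sigma>
  proof -
    obtain c where c: "c \<in> carrier G" "closed_simplex \<sigma> \<subseteq> \<rho> c ` F" using F[OF \<sigma>] by blast
    have "leaf_map z \<in> \<alpha> c ` leaf_map ` F" if z: "z \<in> closed_simplex \<sigma>" for z
    proof -
      obtain w where w: "w \<in> F" "z = \<rho> c w" using c z by blast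
      then show ?thesis using leaf_map_equivariant[OF c(1), of w] FK by auto
    qed
    then show ?thesis using c(1) by blast
  qed
  from assms(3) show ?thesis
  proof (induction rule: chain.induct)
    case (refl x)
    then obtain \<sigma> where \<sigma>: "\<sigma> \<in> K" "x \<in> closed_simplex \<sigma>" by (auto simp: realization_def)
    obtain c where c: "c \<in> carrier G" "leaf_map ` closed_simplex \<sigma> \<subseteq> \<alpha> c ` leaf_map ` F"
      using simplex[OF \<sigma>(1)] by blast
    show ?case
      by (rule exI[of _ "{c}"], rule exI[of _ "{leaf_map x}"]) (use c \<sigma> in auto)
  next
    case (step x y m \<sigma> z)
    then obtain C S where CS: "finite C" "C \<subseteq> carrier G" "connected S" "leaf_map x \<in> S" "leaf_map y \<in> S"
      "S \<subseteq> (\<Union>c\<in>C. \<alpha> c ` leaf_map ` F)" by blast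
    obtain c where c: "c \<in> carrier G" "leaf_map ` closed_simplex \<sigma> \<subseteq> \<alpha> c ` leaf_map ` F"
      using simplex[OF step.hyps(2)] by blast
    have "connected (S \<union> leaf_map ` closed_simplex \<sigma>)"
      using CS connected_compact_segment[OF compact_segment_leaf_map_simplex[OF step.hyps(2)]] step.hyps(3)
      by (intro connected_Un) auto
    moreover have "S \<union> leaf_map ` closed_simplex \<sigma> \<subseteq> (\<Union>c\<in>insert c C. \<alpha> c ` leaf_map ` F)"
      unfolding UN_insert by (rule Un_least[OF le_supI2[OF CS(6)] le_supI1[OF c(2)]])
    moreover have "leaf_map z \<in> leaf_map ` closed_simplex \<sigma>" using step.hyps(4) by simp
    ultimately show ?case
      using CS(1,2,4) c(1)
      by (intro exI[of _ "insert c C"] exI[of _ "S \<union> leaf_map ` closed_simplex \<sigma>"]) simp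
  qed
qed

text \<open>Take for \<open>P\<close> the image of a finite subcomplex \<open>F\<close> whose translates cover, and for \<open>N\<close>
  the set of \<open>g\<close> such that \<open>g F\<close> meets \<open>F\<close>.\<close>

lemma exists_coarsely_connected_cover: "\<exists>P N. coarsely_connected_cover G \<alpha> P N"
proof -
  interpret group G by (rule isometric_actionD(1)[OF action])
  obtain \<Phi> where \<Phi>: "finite \<Phi>" "\<Phi> \<subseteq> K"
    and fund: "\<forall>\<tau>\<in>K. \<exists>g\<in>carrier G. closed_simplex \<tau> \<subseteq> \<rho> g ` (\<Union>\<sigma>\<in>\<Phi>. closed_simplex \<sigma>)"
    by (rule finite_fundamental_subcomplex)
  define F where "F = (\<Union>\<sigma>\<in>\<Phi>. closed_simplex \<sigma>)"
  have F: "\<exists>g\<in>carrier G. closed_simplex \<tau> \<subseteq> \<rho> g ` F" if "\<tau> \<in> K" for \<tau>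
    using bspec[OF fund that] unfolding F_def .
  define P where "P = leaf_map ` F"
  define N where "N = {g \<in> carrier G. \<rho> g ` F \<inter> F \<noteq> {}}"
  have FK: "F \<subseteq> realization K"
    unfolding F_def using \<Phi>(2) closed_simplex_subset_realization by blast
  have "compactin (weak_topology K) F"
    unfolding F_def using \<Phi> finite_simplex by (intro compactin_Union) (auto intro: compactin_closed_simplex)
  then have finN: "finite N"
    using proper unfolding properly_discontinuous_action_def N_def by blast
  have segP: "segment_union P"
    unfolding P_def F_def image_UN
    using \<Phi> compact_segment_leaf_map_simplex by (intro segment_union_UN segment_union_compact_segment) auto
  have over: "\<alpha> g ` P = leaf_map ` \<rho> g ` F" if "g \<in> carrier G" for g
    unfolding P_def image_image using leaf_map_equivariant[OF that] FK by (intro image_cong) auto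
  have step: "overlap F U \<subseteq> cover_step G \<alpha> P N U" for U
  proof (rule subrelI)
    fix g k assume "(g, k) \<in> overlap F U"
    then obtain z where gk: "g \<in> carrier G" "k \<in> carrier G"
      and z: "z \<in> realization K" "leaf_map z \<in> U" "z \<in> \<rho> g ` F" "z \<in> \<rho> k ` F"
      by (auto simp: overlap_def)
    obtain a b where ab: "a \<in> F" "z = \<rho> g a" "b \<in> F" "z = \<rho> k b" using z by blast
    have real: "a \<in> realization K" "b \<in> realization K" using ab FK by auto
    have "\<rho> (inv\<^bsub>G\<^esub> g \<otimes>\<^bsub>G\<^esub> k) b = \<rho> (inv\<^bsub>G\<^esub> g) (\<rho> g a)"
      using action_complex(2)[OF real(2) inv_closed[OF gk(1)] gk(2)] ab by simp
    also have "\<dots> = a" by (rule action_complex(3)[OF real(1) gk(1,1)])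
    finally have "a \<in> \<rho> (inv\<^bsub>G\<^esub> g \<otimes>\<^bsub>G\<^esub> k) ` F \<inter> F" using ab by force
    then have "inv\<^bsub>G\<^esub> g \<otimes>\<^bsub>G\<^esub> k \<in> N" using gk unfolding N_def by blast
    moreover have "leaf_map z \<in> \<alpha> g ` P \<inter> U" "leaf_map z \<in> \<alpha> k ` P \<inter> U"
      unfolding over[OF gk(1)] over[OF gk(2)] using z by blast+
    ultimately show "(g, k) \<in> cover_step G \<alpha> P N U"
      unfolding cover_step_def using gk by blast
  qed
  show ?thesis
    unfolding coarsely_connected_cover_def
  proof (rule exI[of _ P], rule exI[of _ N], intro conjI allI impI)
    show "segment_union P" "finite N" by fact+
    show "N \<subseteq> carrier G" by (auto simp: N_def)
    fix x
    obtain z where z: "z \<in> realization K" "leaf_map z = x" by (rule leaf_map_surj)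
    obtain g where "g \<in> carrier G" "z \<in> \<rho> g ` F" by (rule translate_containing[OF F z(1)])
    then show "\<exists>g\<in>carrier G. x \<in> \<alpha> g ` P" using over z(2) by blast
    fix y
    obtain w where w: "w \<in> realization K" "leaf_map w = y" by (rule leaf_map_surj)
    obtain m where "chain z w m" using chain_exists[OF z(1) w(1)] by blast
    from chain_finite_cover[OF F FK this]
    show "\<exists>C S. finite C \<and> C \<subseteq> carrier G \<and> connected S \<and> x \<in> S \<and> y \<in> S \<and> S \<subseteq> (\<Union>c\<in>C. \<alpha> c ` P)"
      unfolding P_def z(2) w(2) .
  next
    fix U g k
    assume U: "open U" "connected U" and gk: "g \<in> carrier G" "k \<in> carrier G"
      and "\<alpha> g ` P \<inter> U \<noteq> {}" "\<alpha> k ` P \<inter> U \<noteq> {}"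
    then obtain y z where y: "leaf_map y \<in> U" "y \<in> \<rho> g ` F" and z: "leaf_map z \<in> U" "z \<in> \<rho> k ` F"
      unfolding over[OF gk(1)] over[OF gk(2)] by blast
    have "y \<in> realization K" "z \<in> realization K"
      using y z FK action_complex(1) gk by blast+
    then have "(g, k) \<in> (overlap F U)\<^sup>*"
      using connected_overlap[OF F U _ y(1) gk(1) y(2) _ z(1) gk(2) z(2)] by blast
    then show "(g, k) \<in> (cover_step G \<alpha> P N U)\<^sup>*" using rtrancl_mono[OF step] by blast
  qed
qed

end

lemma geometric_action_coarsely_connected_cover:
  fixes \<alpha> :: "'g \<Rightarrow> 'a::real_tree \<Rightarrow> 'a"
  assumes "geometric_action TYPE('v) G \<alpha>"
  shows "\<exists>P N. coarsely_connected_cover G \<alpha> P N"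
proof -
  obtain K :: "'v set set" and f \<rho> where K: "isometric_action G \<alpha>"
    "simplicial_2_complex K" "connected_space (weak_topology K)" "measured_foliation K f"
    "simplicial_action G K \<rho>" "properly_discontinuous_action G (weak_topology K) \<rho>"
    "cocompact_action G (weak_topology K) \<rho>" and dual: "dual_to G \<alpha> K f \<rho>"
    using assms unfolding geometric_action_def by blast
  obtain h where h: "bij_betw h (UNIV::'a set) (leaf_space K f) \<and>
      (\<forall>x y. leaf_dist K f (h x) (h y) = dist x y) \<and>
      (\<forall>g\<in>carrier G. \<forall>x. h (\<alpha> g x) = \<rho> g ` h x)"
    using conjunct1[OF dual[unfolded dual_to_def]] by (rule exE)
  then have "bij_betw h (UNIV::'a set) (leaf_space K f)"
    "\<And>x y. leaf_dist K f (h x) (h y) = dist x y" "\<And>g x. g \<in> carrier G \<Longrightarrow> h (\<alpha> g x) = \<rho> g ` h x"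
    by simp_all
  moreover have "leaf_dist K f (leaf_rel K f `` {x}) (leaf_rel K f `` {y}) = dist (f e x) (f e y)"
    if "transverse_edge K f e" "x \<in> closed_simplex e" "y \<in> closed_simplex e" for e x y
    using dual that unfolding dual_to_def by blast
  ultimately interpret dual_action K f G \<alpha> \<rho> h
    using K by unfold_locales
  show ?thesis by (rule exists_coarsely_connected_cover)
qed


section \<open>The core is carried by finitely many rectangles\<close>

lemma connected_subset_component:
  assumes "\<delta> \<in> components (UNIV - {y})" "connected V" "V \<inter> \<delta> \<noteq> {}" "y \<notin> V"
  shows "V \<subseteq> \<delta>"
proof (rule components_maximal[OF assms(1,2)])
  show "V \<subseteq> UNIV - {y}" using assms(4) by blast
qed (use assms(3) in blast)

theorem theorem8p1:
  fixes G :: "('g, 'm) monoid_scheme"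
    and \<alpha>\<^sub>1 :: "'g \<Rightarrow> 'a::real_tree \<Rightarrow> 'a"
    and \<alpha>\<^sub>2 :: "'g \<Rightarrow> 'b::real_tree \<Rightarrow> 'b"
    and b :: "'a \<times> 'b"
  assumes "finitely_generated_group G"
    and "geometric_action TYPE('v) G \<alpha>\<^sub>1"
    and "geometric_action TYPE('w) G \<alpha>\<^sub>2"
  shows "\<exists>D :: ('a \<times> 'b) set.
           (\<exists>\<R>. finite \<R> \<and> (\<forall>R\<in>\<R>. compact_rectangle R) \<and> D = \<Union>\<R>) \<and>
           core G \<alpha>\<^sub>1 \<alpha>\<^sub>2 b \<subseteq> closure (\<Union>g\<in>carrier G. diagonal \<alpha>\<^sub>1 \<alpha>\<^sub>2 g ` D)"
proof -
  have act1: "isometric_action G \<alpha>\<^sub>1" and act2: "isometric_action G \<alpha>\<^sub>2"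
    using assms by (simp_all add: geometric_action_def)
  interpret group G by (rule isometric_actionD(1)[OF act1])
  obtain P\<^sub>1 N\<^sub>1 where cover1: "coarsely_connected_cover G \<alpha>\<^sub>1 P\<^sub>1 N\<^sub>1"
    using geometric_action_coarsely_connected_cover[OF assms(2)] by blast
  obtain P\<^sub>2 N\<^sub>2 where cover2: "coarsely_connected_cover G \<alpha>\<^sub>2 P\<^sub>2 N\<^sub>2"
    using geometric_action_coarsely_connected_cover[OF assms(3)] by blast
  have P: "segment_union P\<^sub>1" "segment_union P\<^sub>2" and N: "finite N\<^sub>1" "finite N\<^sub>2"
    using cover1 cover2 by (simp_all add: coarsely_connected_cover_def)
  have ex1: "\<exists>g\<in>carrier G. u \<in> \<alpha>\<^sub>1 g ` P\<^sub>1" for u using cover1 by (simp add: coarsely_connected_cover_def)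
  have ex2: "\<exists>g\<in>carrier G. u \<in> \<alpha>\<^sub>2 g ` P\<^sub>2" for u using cover2 by (simp add: coarsely_connected_cover_def)
  obtain b\<^sub>1 b\<^sub>2 where b: "b = (b\<^sub>1, b\<^sub>2)" by (cases b)
  \<comment> \<open>The base point need not lie in \<open>P\<^sub>2\<close>; the translation by \<open>a\<close> corrects this.\<close>
  obtain a where a: "a \<in> carrier G" "b\<^sub>2 \<in> \<alpha>\<^sub>2 a ` P\<^sub>2" using ex2 by blast
  obtain E\<^sub>2 where E2: "segment_union E\<^sub>2" "connected E\<^sub>2" "insert b\<^sub>2 ((\<lambda>n. \<alpha>\<^sub>2 n b\<^sub>2) ` N\<^sub>1) \<subseteq> E\<^sub>2"
    using segment_union_connected_hull[OF segment_union_empty finite.insertI[OF finite_imageI[OF N(1)]]]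
    by metis
  obtain E\<^sub>1 where E1: "segment_union E\<^sub>1" "connected E\<^sub>1"
    "insert (\<alpha>\<^sub>1 (inv\<^bsub>G\<^esub> a) b\<^sub>1) (insert b\<^sub>1 ((\<lambda>n. \<alpha>\<^sub>1 n b\<^sub>1) ` N\<^sub>2)) \<subseteq> E\<^sub>1"
    using segment_union_connected_hull[OF segment_union_empty finite.insertI[OF finite.insertI[OF finite_imageI[OF N(2)]]]]
    by metis
  \<comment> \<open>Every point of \<open>k E\<^sub>1\<close> lies in \<open>k c P\<^sub>1\<close> for some \<open>c\<close> in the finite set \<open>C\<close>; \<open>Z\<close> is
    large enough to join \<open>P\<^sub>2\<close> to all the points \<open>c b\<^sub>2\<close>.\<close>
  obtain C where C: "finite C" "C \<subseteq> carrier G" "E\<^sub>1 \<subseteq> (\<Union>c\<in>C. \<alpha>\<^sub>1 c ` P\<^sub>1)"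
    by (rule segment_union_finite_cover[OF cover1 E1(1)])
  obtain Z where Z: "segment_union Z" "connected Z" "P\<^sub>2 \<subseteq> Z" "(\<lambda>c. \<alpha>\<^sub>2 c b\<^sub>2) ` C \<subseteq> Z"
    by (rule segment_union_connected_hull[OF P(2) finite_imageI[OF C(1)]])
  define D where "D = P\<^sub>1 \<times> E\<^sub>2 \<union> E\<^sub>1 \<times> Z"
  define GD where "GD = (\<Union>g\<in>carrier G. diagonal \<alpha>\<^sub>1 \<alpha>\<^sub>2 g ` D)"
  have GD: "(\<alpha>\<^sub>1 g u, \<alpha>\<^sub>2 g v) \<in> GD" if "g \<in> carrier G" "u \<in> P\<^sub>1 \<and> v \<in> E\<^sub>2 \<or> u \<in> E\<^sub>1 \<and> v \<in> Z" for g u v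
  proof -
    have "(\<alpha>\<^sub>1 g u, \<alpha>\<^sub>2 g v) = diagonal \<alpha>\<^sub>1 \<alpha>\<^sub>2 g (u, v)" by (simp add: diagonal_def)
    moreover have "(u, v) \<in> D" using that(2) by (auto simp: D_def)
    ultimately show ?thesis using that(1) unfolding GD_def by blast
  qed
  have "core G \<alpha>\<^sub>1 \<alpha>\<^sub>2 b \<subseteq> closure GD"
  proof (rule subsetI, rule ccontr)
    fix x assume core: "x \<in> core G \<alpha>\<^sub>1 \<alpha>\<^sub>2 b" and far: "x \<notin> closure GD"
    obtain x\<^sub>1 x\<^sub>2 where x: "x = (x\<^sub>1, x\<^sub>2)" by (cases x)
    have "open (- closure GD)" "x \<in> - closure GD" using far by auto
    then obtain A B where AB: "open A" "open B" "x \<in> A \<times> B" "A \<times> B \<subseteq> - closure GD"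
      by (rule open_prod_elim)
    obtain r\<^sub>1 where r1: "r\<^sub>1 > 0" "ball x\<^sub>1 r\<^sub>1 \<subseteq> A" using AB(1,3) x open_contains_ball by blast
    obtain r\<^sub>2 where r2: "r\<^sub>2 > 0" "ball x\<^sub>2 r\<^sub>2 \<subseteq> B" using AB(2,3) x open_contains_ball by blast
    have avoid: False if "u \<in> ball x\<^sub>1 r\<^sub>1" "v \<in> ball x\<^sub>2 r\<^sub>2" "(u, v) \<in> GD" for u v
      using that r1(2) r2(2) AB(4) closure_subset by blast
    \<comment> \<open>A point of \<open>M\<^sub>2\<close> in the ball around \<open>x\<^sub>2\<close>, or of \<open>M\<^sub>1\<close> in the ball around \<open>x\<^sub>1\<close>, would
      give a point of \<open>G.D\<close> in the product of the balls.\<close>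
    define M\<^sub>2 where "M\<^sub>2 = translates_over G \<alpha>\<^sub>1 P\<^sub>1 (ball x\<^sub>1 r\<^sub>1) \<alpha>\<^sub>2 E\<^sub>2"
    define M\<^sub>1 where "M\<^sub>1 = translates_over G \<alpha>\<^sub>2 P\<^sub>2 (ball x\<^sub>2 r\<^sub>2) \<alpha>\<^sub>1 E\<^sub>1"
    have M2I: "\<alpha>\<^sub>2 k b\<^sub>2 \<in> M\<^sub>2" if "k \<in> carrier G" "u \<in> \<alpha>\<^sub>1 k ` P\<^sub>1" "u \<in> ball x\<^sub>1 r\<^sub>1" for k u
      using that E2(3) unfolding M\<^sub>2_def translates_over_def by blast
    have M1I: "\<alpha>\<^sub>1 k b\<^sub>1 \<in> M\<^sub>1" if "k \<in> carrier G" "u \<in> \<alpha>\<^sub>2 k ` P\<^sub>2" "u \<in> ball x\<^sub>2 r\<^sub>2" for k u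
      using that E1(3) unfolding M\<^sub>1_def translates_over_def by blast
    have "connected M\<^sub>2"
      unfolding M\<^sub>2_def using E2
      by (intro connected_translates_over[OF cover1 act2, of _ b\<^sub>2]) (auto intro: connected_ball_real_tree)
    moreover have "M\<^sub>2 \<noteq> {}" using ex1[of x\<^sub>1] M2I r1(1) by fastforce
    moreover have "M\<^sub>2 \<inter> ball x\<^sub>2 r\<^sub>2 = {}"
    proof (rule ccontr)
      assume "M\<^sub>2 \<inter> ball x\<^sub>2 r\<^sub>2 \<noteq> {}"
      then obtain k e u where "k \<in> carrier G" "u \<in> P\<^sub>1" "\<alpha>\<^sub>1 k u \<in> ball x\<^sub>1 r\<^sub>1" "e \<in> E\<^sub>2" "\<alpha>\<^sub>2 k e \<in> ball x\<^sub>2 r\<^sub>2"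
        unfolding M\<^sub>2_def translates_over_def by blast
      then show False using avoid GD by blast
    qed
    ultimately obtain y\<^sub>2 \<eta> where \<eta>: "y\<^sub>2 \<in> ball x\<^sub>2 r\<^sub>2" "\<eta> \<in> components (UNIV - {y\<^sub>2})" "x\<^sub>2 \<in> \<eta>"
      "\<eta> \<inter> M\<^sub>2 = {}" "open \<eta>" "connected \<eta>"
      by (rule direction_separating_connected[OF r2(1)])
    have "connected M\<^sub>1"
      unfolding M\<^sub>1_def using E1
      by (intro connected_translates_over[OF cover2 act1, of _ b\<^sub>1]) (auto intro: connected_ball_real_tree)
    moreover have "M\<^sub>1 \<noteq> {}" using ex2[of x\<^sub>2] M1I r2(1) by fastforce
    moreover have "M\<^sub>1 \<inter> ball x\<^sub>1 r\<^sub>1 = {}"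
    proof (rule ccontr)
      assume "M\<^sub>1 \<inter> ball x\<^sub>1 r\<^sub>1 \<noteq> {}"
      then obtain k e u where "k \<in> carrier G" "u \<in> P\<^sub>2" "\<alpha>\<^sub>2 k u \<in> ball x\<^sub>2 r\<^sub>2" "e \<in> E\<^sub>1" "\<alpha>\<^sub>1 k e \<in> ball x\<^sub>1 r\<^sub>1"
        unfolding M\<^sub>1_def translates_over_def by blast
      then show False using avoid GD Z(3) by blast
    qed
    ultimately obtain y\<^sub>1 \<delta> where \<delta>: "y\<^sub>1 \<in> ball x\<^sub>1 r\<^sub>1" "\<delta> \<in> components (UNIV - {y\<^sub>1})" "x\<^sub>1 \<in> \<delta>"
      "\<delta> \<inter> M\<^sub>1 = {}" "open \<delta>" "connected \<delta>"
      by (rule direction_separating_connected[OF r1(1)])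
    \<comment> \<open>The quadrant contains \<open>x\<close>; that it contains no orbit point at all is what remains to
      be shown.\<close>
    have "quadrant (\<delta> \<times> \<eta>)"
      unfolding quadrant_def direction_def using \<delta>(2) \<eta>(2) by blast
    then have "heavy G \<alpha>\<^sub>1 \<alpha>\<^sub>2 b (\<delta> \<times> \<eta>)"
      using core \<delta>(3) \<eta>(3) unfolding core_def x by blast
    then obtain g where g: "g \<in> carrier G" "\<alpha>\<^sub>1 g b\<^sub>1 \<in> \<delta>" "\<alpha>\<^sub>2 g b\<^sub>2 \<in> \<eta>"
      unfolding heavy_def b diagonal_def by auto
    \<comment> \<open>Inside \<open>\<eta>\<close> the second cover links \<open>g\<close> to an element over \<open>x\<^sub>2\<close>, so the trace of \<open>\<eta>\<close> in
      the first tree goes from \<open>\<delta>\<close> to \<open>M\<^sub>1\<close> and crosses \<open>y\<^sub>1\<close>.\<close>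
    define V where "V = translates_over G \<alpha>\<^sub>2 P\<^sub>2 \<eta> \<alpha>\<^sub>1 E\<^sub>1"
    have connV: "connected V"
      unfolding V_def using E1 \<eta>(5,6)
      by (intro connected_translates_over[OF cover2 act1, of _ b\<^sub>1]) auto
    have "\<alpha>\<^sub>1 g b\<^sub>1 \<in> V"
    proof -
      have "\<alpha>\<^sub>1 g b\<^sub>1 = \<alpha>\<^sub>1 (g \<otimes>\<^bsub>G\<^esub> a) (\<alpha>\<^sub>1 (inv\<^bsub>G\<^esub> a) b\<^sub>1)"
        using isometric_actionD(2,4)[OF act1] g(1) a(1) by simp
      then have "\<alpha>\<^sub>1 g b\<^sub>1 \<in> \<alpha>\<^sub>1 (g \<otimes>\<^bsub>G\<^esub> a) ` E\<^sub>1" using E1(3) by simp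
      moreover have "\<alpha>\<^sub>2 g b\<^sub>2 \<in> \<alpha>\<^sub>2 (g \<otimes>\<^bsub>G\<^esub> a) ` P\<^sub>2 \<inter> \<eta>"
        using a g isometric_actionD(2)[OF act2 g(1) a(1)] by auto
      moreover have "g \<otimes>\<^bsub>G\<^esub> a \<in> carrier G" using g(1) a(1) by simp
      ultimately show ?thesis unfolding V_def translates_over_def by blast
    qed
    have "V \<inter> M\<^sub>1 \<noteq> {}"
    proof -
      obtain l where l: "l \<in> carrier G" "x\<^sub>2 \<in> \<alpha>\<^sub>2 l ` P\<^sub>2" using ex2 by blast
      have "\<alpha>\<^sub>1 l b\<^sub>1 \<in> M\<^sub>1" using M1I[OF l] r2(1) by simp
      moreover have "\<alpha>\<^sub>1 l b\<^sub>1 \<in> V" using l \<eta>(3) E1(3) unfolding V_def translates_over_def by blast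
      ultimately show ?thesis by blast
    qed
    have "y\<^sub>1 \<in> V"
    proof (rule ccontr)
      assume "y\<^sub>1 \<notin> V"
      then have "V \<subseteq> \<delta>" using \<open>\<alpha>\<^sub>1 g b\<^sub>1 \<in> V\<close> g(2) by (intro connected_subset_component[OF \<delta>(2) connV]) auto
      then show False using \<open>V \<inter> M\<^sub>1 \<noteq> {}\<close> \<delta>(4) by blast
    qed
    then obtain k e u where k: "k \<in> carrier G" "e \<in> E\<^sub>1" "y\<^sub>1 = \<alpha>\<^sub>1 k e" "u \<in> P\<^sub>2" "\<alpha>\<^sub>2 k u \<in> \<eta>"
      unfolding V_def translates_over_def by blast
    \<comment> \<open>Over \<open>y\<^sub>1\<close> the set \<open>k Z\<close> then joins a point of \<open>\<eta>\<close> to a point of \<open>M\<^sub>2\<close>, so it contains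
      \<open>y\<^sub>2\<close>.\<close>
    obtain c p where c: "c \<in> C" "p \<in> P\<^sub>1" "e = \<alpha>\<^sub>1 c p" using C(3) k(2) by blast
    have cG: "c \<in> carrier G" using C(2) c(1) by blast
    have "\<alpha>\<^sub>1 (k \<otimes>\<^bsub>G\<^esub> c) p = y\<^sub>1" using isometric_actionD(2)[OF act1 k(1) cG] k(3) c(3) by simp
    then have "\<alpha>\<^sub>2 (k \<otimes>\<^bsub>G\<^esub> c) b\<^sub>2 \<in> M\<^sub>2"
      using M2I[of "k \<otimes>\<^bsub>G\<^esub> c" y\<^sub>1] k(1) cG c(2) \<delta>(1) by blast
    then have in_M2: "\<alpha>\<^sub>2 k (\<alpha>\<^sub>2 c b\<^sub>2) \<in> M\<^sub>2" using isometric_actionD(2)[OF act2 k(1) cG] by simp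
    have "y\<^sub>2 \<in> \<alpha>\<^sub>2 k ` Z"
    proof (rule ccontr)
      assume "y\<^sub>2 \<notin> \<alpha>\<^sub>2 k ` Z"
      moreover have "\<alpha>\<^sub>2 k u \<in> \<alpha>\<^sub>2 k ` Z \<inter> \<eta>" using k(4,5) Z(3) by blast
      ultimately have "\<alpha>\<^sub>2 k ` Z \<subseteq> \<eta>"
        using connected_translate[OF act2 k(1) Z(2)] by (intro connected_subset_component[OF \<eta>(2)]) auto
      moreover have "\<alpha>\<^sub>2 c b\<^sub>2 \<in> Z" using Z(4) c(1) by blast
      ultimately show False using in_M2 \<eta>(4) by blast
    qed
    then obtain z where "z \<in> Z" "y\<^sub>2 = \<alpha>\<^sub>2 k z" by blast
    then show False using avoid[OF \<delta>(1) \<eta>(1)] GD[OF k(1)] k(2,3) by blast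
  qed
  moreover have "\<exists>\<R>. finite \<R> \<and> (\<forall>R\<in>\<R>. compact_rectangle R) \<and> D = \<Union>\<R>"
  proof -
    obtain \<R>\<^sub>1 where R1: "finite \<R>\<^sub>1" "\<forall>R\<in>\<R>\<^sub>1. compact_rectangle R" "P\<^sub>1 \<times> E\<^sub>2 = \<Union>\<R>\<^sub>1"
      using segment_union_Times_rectangles[OF P(1) E2(1)] by (elim exE conjE) (rule that)
    obtain \<R>\<^sub>2 where R2: "finite \<R>\<^sub>2" "\<forall>R\<in>\<R>\<^sub>2. compact_rectangle R" "E\<^sub>1 \<times> Z = \<Union>\<R>\<^sub>2"
      using segment_union_Times_rectangles[OF E1(1) Z(1)] by (elim exE conjE) (rule that)
    show ?thesis
      by (rule exI[of _ "\<R>\<^sub>1 \<union> \<R>\<^sub>2"]) (use R1 R2 in \<open>auto simp: D_def\<close>)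
  qed
  ultimately show ?thesis unfolding GD_def by blast
qed

end
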